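(* In the grid-based current status model described in the context, with fixed scale constant $c>0$ and fixed sparsity exponent $\gamma\in(0,1/3)$ (so the grid spacing is $\delta_n=cn^{-\gamma}$), suppose that $F$ is once continuously differentiable in a neighborhood of $x_0\in(a,b)$ and that: (A1.1) $F$ has a bounded density $f$ on $[a,b]$, and there is $f_l>0$ with $f(x)>f_l$ for every $x\in[a,b]$; (A1.2) $G$ has a bounded density $g$ on $[a,b]$, and there is $g_l>0$ with $g(x)\ge g_l$ for every $x\in[a,b]$; (A1.3) $a'<a$ and $F(a)>0$. Then, as $n\to\infty$, $$\Big(\sqrt{N_l}\,\big(\hat F(t_l)-F(t_l)\big),\ \sqrt{N_r}\,\big(\hat F(t_r)-F(t_r)\big)\Big)\ \xrightarrow{d}\ \sqrt{F(x_0)(1-F(x_0))}\;N(0,I_2),$$ where $I_2$ is the $2\times 2$ identity matrix.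
   Context: Model. $F$ is a distribution function with Lebesgue density $f$ concentrated on $[a',b']$ with $0\le a'<b'<\infty$ (or on $[a',\infty)$, in which case put $b'=\infty$), and $a'\le a<b<b'$. $G$ is an absolutely continuous distribution function whose support contains $[a,b]$, with Lebesgue density $g$. For $c>0$ and $\gamma\in(0,1]$ let $\delta=\delta_n=cn^{-\gamma}$, $K=K_n=\lfloor (b-a)/\delta_n\rfloor$ and $t_i=t_{i,n}=a+i\delta_n$, $i=1,\dots,K$. Let $H_n$ be the discrete distribution on $\{t_1,\dots,t_K\}$ with $H_n\{t_1\}=G(t_1)$, $H_n\{t_i\}=G(t_i)-G(t_{i-1})$ for $2\le i\le K-1$, and $H_n\{t_K\}=1-G(t_{K-1})$. For each $n$, $T_{1},\dots,T_{n}$ are i.i.d. $F$, $X_{1},\dots,X_{n}$ are i.i.d. $H_n$, the two samples are independent (triangular array; dependence on $n$ suppressed), and one observes $(X_i,Y_i)$, $Y_i=1\{T_i\le X_i\}$, $i=1,\dots,n$. Grid points of interest. $x_0\in(a,b)$ is fixed; $t_l=t_{l,n}$ is the largest grid point $\le x_0$, and $t_r=t_{l+1}$ is the next grid point to the right of $t_l$ (both exist for $n$ large). Counts. $N_i=\sum_{j=1}^n 1\{X_j=t_i\}$; $N_l,N_r$ are the counts at $t_l,t_r$. NPMLE. $\hat F$ is the nonparametric maximum likelihood estimator of $F$ under monotonicity: with $Z_i=\sum_{j}Y_j1\{X_j=t_i\}$ and $\bar Z_i=Z_i/N_i$, the vector $(\hat F(t_1),\dots,\hat F(t_K))$ is the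 weighted isotonic regression, i.e. minimizes $\sum_{i=1}^K N_i(\bar Z_i-F_i)^2$ over $F_1\le\dots\le F_K$, and $\hat F$ is extended to $[a,b]$ as a right-continuous step function, constant on each $[t_i,t_{i+1})$ and on $[t_K,b]$, and equal to $0$ on $[a,t_1)$. Equivalently, with $G_n(t)=n^{-1}\sum_j 1\{X_j\le t\}$ and $V_n(t)=n^{-1}\sum_j Y_j1\{X_j\le t\}$, $\hat F(x)$ is the left derivative at $G_n(x)$ of the greatest convex minorant of the point set $\{(G_n(t),V_n(t)):t\in[a,b]\}$ (this also fixes the values at grid points with $N_i=0$; by convention $\hat F(x)=0$ if $G_n(x)=0$). *)

theory Defs
  imports "HOL-Probability.Probability"
begin

definition has_lebesgue_density :: "(real \<Rightarrow> real) \<Rightarrow> (real \<Rightarrow> real) \<Rightarrow> bool" where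
  "has_lebesgue_density F f \<longleftrightarrow>
     f \<in> borel_measurable borel \<and> (\<forall>x. 0 \<le> f x) \<and>
     prob_space (density lborel (\<lambda>x. ennreal (f x))) \<and>
     F = cdf (density lborel (\<lambda>x. ennreal (f x)))"

(* weak_conv_m of the library is restricted to measures on the real line *)
definition weak_conv_measures :: "(nat \<Rightarrow> 'b::topological_space measure) \<Rightarrow> 'b measure \<Rightarrow> bool" where
  "weak_conv_measures \<mu> \<nu> \<longleftrightarrow>
     (\<forall>h :: 'b \<Rightarrow> real. continuous_on UNIV h \<longrightarrow> bounded (range h) \<longrightarrow>
        (\<lambda>n. integral\<^sup>L (\<mu> n) h) \<longlonglongrightarrow> integral\<^sup>L \<nu> h)"

subsection \<open>The grid and the design distribution\<close>

definition spacing :: "real \<Rightarrow> real \<Rightarrow> nat \<Rightarrow> real" where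
  "spacing c \<gamma> n = c * real n powr (- \<gamma>)"

definition grid_size :: "real \<Rightarrow> real \<Rightarrow> real \<Rightarrow> nat" where
  "grid_size a b \<delta> = nat \<lfloor>(b - a) / \<delta>\<rfloor>"

definition grid_point :: "real \<Rightarrow> real \<Rightarrow> nat \<Rightarrow> real" where
  "grid_point a \<delta> i = a + real i * \<delta>"

definition grid_index :: "nat \<Rightarrow> (nat \<Rightarrow> real) \<Rightarrow> real \<Rightarrow> nat" where
  "grid_index K t x = Max {i \<in> {1..K}. t i \<le> x}"

(* A probability distribution only for K >= 2. *)
definition grid_law :: "(real \<Rightarrow> real) \<Rightarrow> nat \<Rightarrow> (nat \<Rightarrow> real) \<Rightarrow> real measure" where
  "grid_law G K t =
     distr (point_measure {1..K}
              (\<lambda>i. ennreal (if i = 1 then G (t 1)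
                            else if i = K then 1 - G (t (K - 1))
                            else G (t i) - G (t (i - 1)))))
           borel t"

(* The case_sum family lists T 1, ..., T n, X 1, ..., X n: its independence says that each of the
   two samples is independent and that the samples are independent of each other. *)
definition current_status_sample ::
    "'w measure \<Rightarrow> nat \<Rightarrow> (real \<Rightarrow> real) \<Rightarrow> real measure \<Rightarrow>
     (nat \<Rightarrow> 'w \<Rightarrow> real) \<Rightarrow> (nat \<Rightarrow> 'w \<Rightarrow> real) \<Rightarrow> bool" where
  "current_status_sample M n f H T X \<longleftrightarrow>
     prob_space M \<and>
     (\<forall>j\<in>{1..n}. distributed M lborel (T j) (\<lambda>x. ennreal (f x))) \<and>
     (\<forall>j\<in>{1..n}. X j \<in> borel_measurable M \<and> distr M borel (X j) = H) \<and>
     prob_space.indep_vars M (\<lambda>_. borel) (case_sum T X) ({1..n} <+> {1..n})"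

subsection \<open>The nonparametric maximum likelihood estimator\<close>

text \<open>From here on \<open>T\<close> and \<open>X\<close> are the realized values of the two samples.\<close>

definition obs_count :: "nat \<Rightarrow> (nat \<Rightarrow> real) \<Rightarrow> real \<Rightarrow> nat" where
  "obs_count n X s = card {j \<in> {1..n}. X j = s}"

definition event_count :: "nat \<Rightarrow> (nat \<Rightarrow> real) \<Rightarrow> (nat \<Rightarrow> real) \<Rightarrow> real \<Rightarrow> nat" where
  "event_count n T X s = card {j \<in> {1..n}. X j = s \<and> T j \<le> X j}"

definition isotonic_regression ::
    "nat \<Rightarrow> (nat \<Rightarrow> real) \<Rightarrow> (nat \<Rightarrow> real) \<Rightarrow> (nat \<Rightarrow> real) \<Rightarrow> bool" where
  "isotonic_regression K w z v \<longleftrightarrow>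
     mono_on {1..K} v \<and>
     (\<forall>u. mono_on {1..K} u \<longrightarrow>
        (\<Sum>i=1..K. w i * (z i - v i)\<^sup>2) \<le> (\<Sum>i=1..K. w i * (z i - u i)\<^sup>2))"

text \<open>The least squares criterion does not determine the value at a grid point without
  observations. There the left derivative of the greatest convex minorant of the cumulative sum
  diagram is taken at the same abscissa as at the preceding grid point, so the preceding value is
  repeated; it is 0 if there is no observation up to that grid point.\<close>

definition is_npmle_vector ::
    "nat \<Rightarrow> (nat \<Rightarrow> real) \<Rightarrow> (nat \<Rightarrow> real) \<Rightarrow> (nat \<Rightarrow> real) \<Rightarrow> bool" where
  "is_npmle_vector K w z v \<longleftrightarrow>
     isotonic_regression K w z v \<and>
     (\<forall>i\<in>{1..K}. w i = 0 \<longrightarrow> v i = (if i = 1 then 0 else v (i - 1)))"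

(* By is_npmle_vector_exists and is_npmle_vector_unique below, the choice of v is possible and
   determines v on {1..K}, the only indices that are used. The quotient is 0 at grid points
   without observations, where it has weight 0. *)
definition npmle ::
    "nat \<Rightarrow> (nat \<Rightarrow> real) \<Rightarrow> nat \<Rightarrow> (nat \<Rightarrow> real) \<Rightarrow> (nat \<Rightarrow> real) \<Rightarrow> real \<Rightarrow> real" where
  "npmle K t n T X x =
     (let v = (SOME v. is_npmle_vector K (\<lambda>i. real (obs_count n X (t i)))
                 (\<lambda>i. real (event_count n T X (t i)) / real (obs_count n X (t i))) v)
      in if x < t 1 then 0 else v (grid_index K t x))"

lemma is_npmle_vector_unique:
  assumes w: "\<And>i. i \<in> {1..K} \<Longrightarrow> 0 \<le> w i"
    and u: "is_npmle_vector K w z u" and v: "is_npmle_vector K w z v" and i: "i \<in> {1..K}"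
  shows "u i = v i"
proof -
  define S where "S x = (\<Sum>i=1..K. w i * (z i - x i)\<^sup>2)" for x :: "nat \<Rightarrow> real"
  define m where "m i = (u i + v i) / 2" for i
  have mu: "mono_on {1..K} u" and mv: "mono_on {1..K} v"
    and Su: "\<And>x. mono_on {1..K} x \<Longrightarrow> S u \<le> S x" and Sv: "\<And>x. mono_on {1..K} x \<Longrightarrow> S v \<le> S x"
    using u v by (auto simp: is_npmle_vector_def isotonic_regression_def S_def)
  have mm: "mono_on {1..K} m"
    unfolding m_def using mu mv by (auto simp: monotone_on_def intro!: divide_right_mono add_mono)
  have "S u + S v - 2 * S m = (\<Sum>i=1..K. w i * (u i - v i)\<^sup>2 / 2)"
    unfolding S_def m_def
    by (simp add: sum.distrib[symmetric] sum_subtractf[symmetric] sum_distrib_left)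
       (intro sum.cong refl, simp add: power2_eq_square field_simps)
  moreover have "S u + S v - 2 * S m \<le> 0" using Su[OF mm] Sv[OF mm] by simp
  moreover have nn: "\<And>i. i \<in> {1..K} \<Longrightarrow> 0 \<le> w i * (u i - v i)\<^sup>2 / 2" using w by simp
  ultimately have "(\<Sum>i=1..K. w i * (u i - v i)\<^sup>2 / 2) = 0"
    using sum_nonneg[of "{1..K}" "\<lambda>i. w i * (u i - v i)\<^sup>2 / 2"] by fastforce
  then have z: "\<forall>i\<in>{1..K}. w i * (u i - v i)\<^sup>2 / 2 = 0"
    using sum_nonneg_eq_0_iff[of "{1..K}" "\<lambda>i. w i * (u i - v i)\<^sup>2 / 2"] nn by simp
  show ?thesis using i
  proof (induction i)
    case (Suc i)
    show ?case
    proof (cases "w (Suc i) = 0")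
      case True
      then show ?thesis using u v Suc by (cases i) (auto simp: is_npmle_vector_def)
    next
      case False
      then show ?thesis using z Suc.prems by auto
    qed
  qed simp
qed

lemma is_npmle_vector_exists:
  fixes w z :: "nat \<Rightarrow> real"
  assumes w: "\<And>i. i \<in> {1..K} \<Longrightarrow> 0 \<le> w i" and z: "\<And>i. i \<in> {1..K} \<Longrightarrow> 0 \<le> z i \<and> z i \<le> 1"
  shows "\<exists>v. is_npmle_vector K w z v"
proof -
  define S where "S x = (\<Sum>i=1..K. w i * (z i - x i)\<^sup>2)" for x :: "nat \<Rightarrow> real"
  define C where "C = {u :: nat \<Rightarrow> real. \<forall>i. u i \<in> {0..1}}"
  define D where "D = {u :: nat \<Rightarrow> real. mono_on {1..K} u}"
  have "compactin (product_topology (\<lambda>_. euclidean) UNIV) (PiE (UNIV :: nat set) (\<lambda>_. {0..1::real}))"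
    by (simp add: compactin_PiE)
  moreover have "PiE (UNIV :: nat set) (\<lambda>_. {0..1::real}) = C"
    by (auto simp: C_def PiE_def Pi_def)
  ultimately have C: "compact C"
    by (simp add: euclidean_product_topology)
  have "closed D"
    unfolding D_def mono_on_def
    by (intro closed_Collect_all closed_Collect_imp closed_Collect_le
          continuous_on_product_coordinates open_Collect_const)
  with C have CD: "compact (C \<inter> D)" by (rule compact_Int_closed)
  have "(\<lambda>_. 0) \<in> C \<inter> D" by (auto simp: C_def D_def monotone_on_def)
  moreover have "continuous_on (C \<inter> D) S" unfolding S_def
    by (intro continuous_intros continuous_on_subset[OF continuous_on_product_coordinates]) auto
  ultimately obtain v where v: "v \<in> C \<inter> D" and vmin: "\<And>u. u \<in> C \<inter> D \<Longrightarrow> S v \<le> S u"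
    using continuous_attains_inf[OF CD] by blast
  have opt: "S v \<le> S u" if u: "mono_on {1..K} u" for u
  proof -
    define u' where "u' i = max 0 (min 1 (u i))" for i
    have "u' \<in> C \<inter> D" using u by (fastforce simp: C_def D_def u'_def monotone_on_def)
    then have "S v \<le> S u'" by (rule vmin)
    also have "S u' \<le> S u" unfolding S_def
    proof (intro sum_mono mult_left_mono w)
      fix i assume "i \<in> {1..K}"
      with z[of i] have "\<bar>z i - u' i\<bar> \<le> \<bar>z i - u i\<bar>" by (auto simp: u'_def)
      then show "(z i - u' i)\<^sup>2 \<le> (z i - u i)\<^sup>2" by (simp add: abs_le_square_iff)
    qed
    finally show ?thesis .
  qed
  define J where "J i = {j \<in> {1..i}. w j \<noteq> 0}" for i
  define v' where "v' i = (if J i = {} then 0 else v (Max (J i)))" for i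
  have fin: "finite (J i)" for i by (simp add: J_def)
  have MaxJ: "Max (J i) \<in> {1..i}" if "J i \<noteq> {}" for i
    using Max_in[OF fin that] by (auto simp: J_def)
  have "mono_on {1..K} v'"
  proof (rule mono_onI)
    fix r s assume rs: "r \<in> {1..K}" "s \<in> {1..K}" "r \<le> s"
    then have sub: "J r \<subseteq> J s" by (auto simp: J_def)
    show "v' r \<le> v' s"
    proof (cases "J r = {}")
      case True
      then show ?thesis using v by (auto simp: v'_def C_def)
    next
      case False
      with sub have ne: "J s \<noteq> {}" by blast
      have "Max (J r) \<le> Max (J s)" using Max_mono[OF sub False fin] .
      moreover have "Max (J r) \<in> {1..K}" "Max (J s) \<in> {1..K}"
        using MaxJ[OF False] MaxJ[OF ne] rs by auto
      ultimately have "v (Max (J r)) \<le> v (Max (J s))" using v by (auto simp: D_def monotone_on_def)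
      then show ?thesis using False ne by (simp add: v'_def)
    qed
  qed
  moreover have "S v' = S v" unfolding S_def
  proof (intro sum.cong refl)
    fix i assume i: "i \<in> {1..K}"
    have "v' i = v i" if "w i \<noteq> 0"
    proof -
      have iJ: "i \<in> J i" using that i by (simp add: J_def)
      then have "Max (J i) = i" using fin by (intro Max_eqI) (auto simp: J_def)
      then show ?thesis using iJ by (auto simp: v'_def)
    qed
    then show "w i * (z i - v' i)\<^sup>2 = w i * (z i - v i)\<^sup>2" by (cases "w i = 0") auto
  qed
  moreover have "v' i = (if i = 1 then 0 else v' (i - 1))" if i: "i \<in> {1..K}" and "w i = 0" for i
  proof -
    have "j \<le> i - 1" if "j \<le> i" "w j \<noteq> 0" for j
      using that \<open>w i = 0\<close> by (cases "j = i") auto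
    moreover have "j \<le> i" if "j \<le> i - 1" for j using that by simp
    ultimately have Ji: "J i = J (i - 1)" unfolding J_def by fastforce
    have "J 0 = {}" by (simp add: J_def)
    then have "J i = {}" if "i = 1" using Ji that by simp
    then show ?thesis unfolding v'_def Ji by (cases "i = 1") (simp_all add: Ji)
  qed
  ultimately have "is_npmle_vector K w z v'"
    using opt by (auto simp: is_npmle_vector_def isotonic_regression_def S_def)
  then show ?thesis by blast
qed

end

theory Submission
  imports Defs "HOL-Real_Asymp.Real_Asymp"
begin

text \<open>Neighbouring grid points differ in \<open>F\<close> by at least \<open>f_l * \<delta>\<close>, while a site has about \<open>n * \<delta>\<close>
  observations. By a Chernoff bound the naive estimator at a site deviates from \<open>F\<close> by
  \<open>f_l * \<delta> / 2\<close> or more with probability at most \<open>2 * exp (- const * n * \<delta> ^ 3)\<close>. Summed over the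
  \<open>O(1 / \<delta>)\<close> sites this tends to 0 because \<open>\<gamma> < 1/3\<close>. Outside this event the naive
  estimator is monotone and every site is observed, hence equal to the NPMLE.

  For the naive estimator, condition on the sets of indices observed at \<open>t\<^sub>l\<close> and \<open>t\<^sub>r\<close>. These sets
  are disjoint, so the two standardized sums of centred indicators are independent. Each of them is
  asymptotically normal by the central limit theorem for triangular arrays, uniformly in the index
  set as its size grows, and the sizes tend to infinity in probability. Joint convergence against
  a bounded continuous function on the plane is reduced to pointwise convergence by Skorohod's theorem
  in each coordinate.\<close>

section \<open>Weak convergence\<close>

text \<open>Conditioning leaves a pair of index sets of arbitrary shape, so a limit theorem along
  one prescribed sequence of sets does not suffice. Uniformity is obtained by contradiction: a
  failure would supply disjoint sets of growing size, and these form a triangular array to which the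
  limit theorem applies. Both tail bounds come from one formula for the mean of a product over the
  observations at a site: a constant factor controls the count, an exponentially tilted residual
  controls the deviation. With \<open>\<theta> = f_l * \<delta> / 2\<close>, half the guaranteed gap
  of \<open>F\<close>, and site mass at least \<open>g_l * \<delta>\<close>, the Chernoff exponent
  is of order \<open>n * \<delta> * \<theta>\<^sup>2\<close>, that is, n to the power
  \<open>1 - 3 * \<gamma>\<close>. The variances at the two sites differ for each n; continuity of
  \<open>F\<close> at \<open>x0\<close> gives them the same limit.\<close>

lemma exp_minus_approx:
  fixes x :: real
  assumes "0 \<le> x"
  shows "\<bar>1 - x - exp (- x)\<bar> \<le> x\<^sup>2"
proof -
  have "1 - x \<le> exp (- x)"
    using exp_ge_add_one_self[of "- x"] by simp
  moreover have "exp (- x) \<le> 1 - x + x\<^sup>2"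
  proof -
    have "(1 + x) * exp (- x) \<le> 1"
      using mult_right_mono[OF exp_ge_add_one_self[of x], of "exp (- x)"]
      by (simp add: exp_minus field_simps)
    moreover have "(1 + x) * (1 - x + x\<^sup>2) = 1 + x ^ 3"
      by (simp add: algebra_simps power2_eq_square power3_eq_cube)
    ultimately have "(1 + x) * exp (- x) \<le> (1 + x) * (1 - x + x\<^sup>2)"
      using assms by (smt (verit) zero_le_power)
    then show ?thesis
      using assms by (simp add: mult_le_cancel_left)
  qed
  ultimately show ?thesis by simp
qed

lemma real_distribution_scaled_normal:
  "real_distribution (distr std_normal_distribution borel (\<lambda>x. \<sigma> * x))"
  by (intro prob_space.real_distribution_distr prob_space_normal_density) auto

lemma char_scaled_normal:
  "char (distr std_normal_distribution borel (\<lambda>x. \<sigma> * x)) s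
     = complex_of_real (exp (- (s\<^sup>2 * \<sigma>\<^sup>2 / 2)))"
proof -
  have "char (distr std_normal_distribution borel (\<lambda>x. \<sigma> * x)) s
     = char std_normal_distribution (s * \<sigma>)"
    unfolding char_def by (subst integral_distr) (auto simp: mult.assoc)
  then show ?thesis
    by (simp add: char_std_normal_distribution power_mult_distrib)
qed

text \<open>With m = \<open>card J\<close>, the characteristic function of one scaled summand
  differs from its second-order Taylor polynomial by order m to the power -3/2, and that polynomial
  differs from \<open>exp (- x)\<close> by at most \<open>x\<^sup>2\<close>, of order m to the power
  -2. A product of m factors in the unit disc loses at most the sum of these errors. The bound sees
  \<open>J\<close> only through its size.\<close>

lemma char_sum_approx:
  fixes X :: "'i \<Rightarrow> 'w \<Rightarrow> real"
  assumes "prob_space M"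
    and fin: "finite J" "J \<noteq> {}"
    and indep: "prob_space.indep_vars M (\<lambda>_. borel) X J"
    and bdd: "\<And>j \<omega>. j \<in> J \<Longrightarrow> \<bar>X j \<omega>\<bar> \<le> 1"
    and mean: "\<And>j. j \<in> J \<Longrightarrow> integral\<^sup>L M (X j) = 0"
    and var: "\<And>j. j \<in> J \<Longrightarrow> integral\<^sup>L M (\<lambda>\<omega>. (X j \<omega>)\<^sup>2) = v"
  shows "cmod (char (distr M borel (\<lambda>\<omega>. (\<Sum>j\<in>J. X j \<omega>) / sqrt (card J))) s
            - exp (- (s\<^sup>2 * v / 2)))
         \<le> \<bar>s\<bar> ^ 3 / (6 * sqrt (card J)) + (s\<^sup>2 * v / 2)\<^sup>2 / card J"
proof -
  interpret prob_space M by fact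
  define m where "m = real (card J)"
  have m: "0 < m" using fin by (simp add: m_def card_gt_0_iff)
  \<comment> \<open>\<open>1 - x\<close> is the Taylor polynomial of a single factor, and the m-th
    power of \<open>exp (- x)\<close> is the Gaussian value.\<close>
  define x where "x = s\<^sup>2 * v / (2 * m)"
  have rv[measurable]: "X j \<in> borel_measurable M" if "j \<in> J" for j
    using indep that by (auto simp: indep_vars_def)
  have v0: "0 \<le> v"
    using fin var by (metis Bochner_Integration.integral_nonneg all_not_in_conv zero_le_power2)
  then have x0: "0 \<le> x" using m by (simp add: x_def)
  define \<phi> where "\<phi> j = char (distr M borel (\<lambda>\<omega>. X j \<omega> / sqrt m)) s" for j
  have ind': "indep_vars (\<lambda>_. borel) (\<lambda>j \<omega>. X j \<omega> / sqrt m) J"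
    by (rule indep_vars_compose2[OF indep, of "\<lambda>_ y. y / sqrt m"]) auto
  have prod: "char (distr M borel (\<lambda>\<omega>. (\<Sum>j\<in>J. X j \<omega>) / sqrt m)) s = (\<Prod>j\<in>J. \<phi> j)"
    using char_distr_sum[OF ind'] by (simp add: \<phi>_def sum_divide_distrib)
  have each: "cmod (\<phi> j - exp (- x)) \<le> \<bar>s\<bar> ^ 3 / (6 * sqrt m * m) + x\<^sup>2" if j: "j \<in> J" for j
  proof -
    let ?Y = "\<lambda>\<omega>. X j \<omega> / sqrt m"
    note rv[OF j, measurable]
    have [simp]: "integrable M (X j)"
      by (rule integrable_const_bound[where B = 1]) (use bdd j in auto)
    have X2[simp]: "integrable M (\<lambda>\<omega>. (X j \<omega>)\<^sup>2)"
      by (rule integrable_const_bound[where B = 1])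
        (use bdd[OF j] in \<open>auto simp: abs_square_le_1\<close>)
    have v: "expectation (\<lambda>\<omega>. (?Y \<omega>)\<^sup>2) = v / m"
      using var[OF j] m by (simp add: power_divide)
    have "cmod (\<phi> j - (1 - s\<^sup>2 * (v / m) / 2))
        \<le> (s\<^sup>2 / 6) * expectation (\<lambda>\<omega>. min (6 * (?Y \<omega>)\<^sup>2) (\<bar>s\<bar> * \<bar>?Y \<omega>\<bar> ^ 3))"
      unfolding \<phi>_def
    proof (rule char_approx3')
      show "integrable M (\<lambda>x. (X j x / sqrt m)\<^sup>2)"
        using X2 m by (simp add: power_divide)
      show "variance ?Y = v / m" using v mean[OF j] by simp
    qed (use mean[OF j] in auto)
    \<comment> \<open>Of the two entries of the minimum the cubic one has the better order in
      m.\<close>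
    also have "\<dots> \<le> (s\<^sup>2 / 6) * (\<bar>s\<bar> / (sqrt m * m))"
    proof (intro mult_left_mono)
      have "\<bar>?Y \<omega>\<bar> ^ 3 \<le> 1 / (sqrt m * m)" for \<omega>
      proof -
        have "\<bar>?Y \<omega>\<bar> ^ 3 = \<bar>X j \<omega>\<bar> ^ 3 / (sqrt m * m)"
          using m by (simp add: power_divide abs_divide power3_eq_cube)
        also have "\<dots> \<le> 1 / (sqrt m * m)"
          using bdd[OF j, of \<omega>] m by (intro divide_right_mono power_le_one) auto
        finally show ?thesis .
      qed
      then have bound: "\<bar>s\<bar> * \<bar>?Y \<omega>\<bar> ^ 3 \<le> \<bar>s\<bar> / (sqrt m * m)" for \<omega>
        using mult_left_mono[of _ _ "\<bar>s\<bar>"] by (metis abs_ge_zero mult.right_neutral times_divide_eq_right)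
      have le: "min (6 * (?Y \<omega>)\<^sup>2) (\<bar>s\<bar> * \<bar>?Y \<omega>\<bar> ^ 3) \<le> \<bar>s\<bar> / (sqrt m * m)" for \<omega>
        using bound[of \<omega>] by linarith
      have "integrable M (\<lambda>\<omega>. min (6 * (?Y \<omega>)\<^sup>2) (\<bar>s\<bar> * \<bar>?Y \<omega>\<bar> ^ 3))"
        using le by (intro integrable_const_bound[where B = "\<bar>s\<bar> / (sqrt m * m)"])
          (auto simp: min_def not_le)
      then have "expectation (\<lambda>\<omega>. min (6 * (?Y \<omega>)\<^sup>2) (\<bar>s\<bar> * \<bar>?Y \<omega>\<bar> ^ 3))
          \<le> expectation (\<lambda>\<omega>. \<bar>s\<bar> / (sqrt m * m))"
        by (intro integral_mono le) auto
      then show "expectation (\<lambda>\<omega>. min (6 * (?Y \<omega>)\<^sup>2) (\<bar>s\<bar> * \<bar>?Y \<omega>\<bar> ^ 3)) \<le> \<bar>s\<bar> / (sqrt m * m)"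
        by (simp add: prob_space)
    qed simp
    also have "\<dots> = \<bar>s\<bar> ^ 3 / (6 * sqrt m * m)"
      by (simp add: power3_eq_cube power2_eq_square abs_mult[symmetric])
    finally have 1: "cmod (\<phi> j - complex_of_real (1 - x)) \<le> \<bar>s\<bar> ^ 3 / (6 * sqrt m * m)"
      by (simp add: x_def field_simps)
    have "cmod (complex_of_real (1 - x) - exp (- x)) = \<bar>1 - x - exp (- x)\<bar>"
      by (metis norm_of_real of_real_diff)
    then have 2: "cmod (complex_of_real (1 - x) - exp (- x)) \<le> x\<^sup>2"
      using exp_minus_approx[OF x0] by simp
    show ?thesis
      using norm_triangle_mono[OF 1 2] by simp
  qed
  have "exp (- (s\<^sup>2 * v / 2)) = exp (- x) ^ card J"
    using m by (simp add: exp_of_nat_mult[symmetric] x_def m_def field_simps)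
  also have "\<dots> = (\<Prod>j\<in>J. exp (- x))" by simp
  finally have eq: "exp (- (s\<^sup>2 * v / 2)) = (\<Prod>j\<in>J. exp (- x))" .
  have "cmod ((\<Prod>j\<in>J. \<phi> j) - exp (- (s\<^sup>2 * v / 2)))
      = cmod ((\<Prod>j\<in>J. \<phi> j) - (\<Prod>j\<in>J. complex_of_real (exp (- x))))"
    unfolding eq of_real_prod by (rule refl)
  \<comment> \<open>Replacing the factors one at a time costs only their individual differences,
    since all factors have modulus at most 1.\<close>
  also have "\<dots> \<le> (\<Sum>j\<in>J. cmod (\<phi> j - exp (- x)))"
  proof (rule norm_prod_diff)
    fix j assume "j \<in> J"
    then show "cmod (\<phi> j) \<le> 1" unfolding \<phi>_def
      by (intro real_distribution.cmod_char_le_1 real_distribution_distr) auto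
    show "cmod (complex_of_real (exp (- x))) \<le> 1" using x0 by (simp add: norm_of_real)
  qed
  also have "\<dots> \<le> m * (\<bar>s\<bar> ^ 3 / (6 * sqrt m * m) + x\<^sup>2)"
    using sum_mono[of J, OF each] by (simp add: m_def)
  also have "\<dots> = \<bar>s\<bar> ^ 3 / (6 * sqrt m) + (s\<^sup>2 * v / 2)\<^sup>2 / m"
    using m by (simp add: x_def field_simps power2_eq_square)
  finally show ?thesis unfolding prod[symmetric] m_def .
qed

text \<open>Levy continuity reduces the claim to the explicit error bound for characteristic
  functions. The sums are divided by the root of their length and not by their standard deviation,
  so \<open>\<sigma>\<close> appears in the limit and may be 0. Spaces and index sets may change
  freely with n.\<close>

lemma clt_bounded_array:
  fixes X :: "nat \<Rightarrow> 'i \<Rightarrow> 'w \<Rightarrow> real"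
  assumes ps: "\<And>n. prob_space (M n)"
    and indep: "\<And>n. prob_space.indep_vars (M n) (\<lambda>_. borel) (X n) (J n)"
    and bdd: "\<And>n j \<omega>. j \<in> J n \<Longrightarrow> \<bar>X n j \<omega>\<bar> \<le> 1"
    and mean: "\<And>n j. j \<in> J n \<Longrightarrow> integral\<^sup>L (M n) (X n j) = 0"
    and var: "\<And>n j. j \<in> J n \<Longrightarrow> integral\<^sup>L (M n) (\<lambda>\<omega>. (X n j \<omega>)\<^sup>2) = v n"
    and v: "v \<longlonglongrightarrow> \<sigma>\<^sup>2"
    and card: "filterlim (\<lambda>n. card (J n)) at_top sequentially"
  shows "weak_conv_m (\<lambda>n. distr (M n) borel (\<lambda>\<omega>. (\<Sum>j\<in>J n. X n j \<omega>) / sqrt (card (J n))))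
           (distr std_normal_distribution borel (\<lambda>x. \<sigma> * x))"
proof (rule levy_continuity)
  let ?\<mu> = "\<lambda>n. distr (M n) borel (\<lambda>\<omega>. (\<Sum>j\<in>J n. X n j \<omega>) / sqrt (card (J n)))"
  show "real_distribution (?\<mu> n)" for n
  proof -
    interpret prob_space "M n" by (rule ps)
    have [measurable]: "X n j \<in> borel_measurable (M n)" if "j \<in> J n" for j
      using indep[of n] that by (auto simp: indep_vars_def)
    show ?thesis by (intro real_distribution_distr) measurable
  qed
  show "real_distribution (distr std_normal_distribution borel (\<lambda>x. \<sigma> * x))"
    by (rule real_distribution_scaled_normal)
  fix s :: real
  have m: "filterlim (\<lambda>n. real (card (J n))) at_top sequentially"
    by (rule filterlim_compose[OF filterlim_real_sequentially card])
  have "(\<lambda>n. \<bar>s\<bar> ^ 3 / (6 * sqrt (card (J n)))) \<longlonglongrightarrow> 0"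
    by (intro tendsto_divide_0[OF tendsto_const] filterlim_at_top_imp_at_infinity
        filterlim_tendsto_pos_mult_at_top[OF tendsto_const _ filterlim_compose[OF sqrt_at_top m]])
      simp
  moreover have "(\<lambda>n. (s\<^sup>2 * v n / 2)\<^sup>2) \<longlonglongrightarrow> (s\<^sup>2 * \<sigma>\<^sup>2 / 2)\<^sup>2"
    by (intro tendsto_intros v) simp
  then have "(\<lambda>n. (s\<^sup>2 * v n / 2)\<^sup>2 / card (J n)) \<longlonglongrightarrow> 0"
    by (rule tendsto_divide_0) (intro filterlim_at_top_imp_at_infinity m)
  ultimately have bound_lim:
    "(\<lambda>n. \<bar>s\<bar> ^ 3 / (6 * sqrt (card (J n))) + (s\<^sup>2 * v n / 2)\<^sup>2 / card (J n)) \<longlonglongrightarrow> 0"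
    by (rule tendsto_add_zero)
  have "\<forall>\<^sub>F n in sequentially. cmod (char (?\<mu> n) s - exp (- (s\<^sup>2 * v n / 2)))
      \<le> \<bar>s\<bar> ^ 3 / (6 * sqrt (card (J n))) + (s\<^sup>2 * v n / 2)\<^sup>2 / card (J n)"
    \<comment> \<open>The error bound requires a nonempty index set, which growth of the sizes
      provides eventually.\<close>
    using card[unfolded filterlim_at_top, rule_format, of 1]
  proof eventually_elim
    case (elim n)
    then have "0 < card (J n)" by simp
    then show ?case
      by (intro char_sum_approx ps indep bdd mean var) (auto simp: card_gt_0_iff)
  qed
  then have "(\<lambda>n. char (?\<mu> n) s - exp (- (s\<^sup>2 * v n / 2))) \<longlonglongrightarrow> 0"
    using bound_lim by (rule Lim_null_comparison)
  moreover have "(\<lambda>n. complex_of_real (exp (- (s\<^sup>2 * v n / 2))))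
      \<longlonglongrightarrow> complex_of_real (exp (- (s\<^sup>2 * \<sigma>\<^sup>2 / 2)))"
    by (intro tendsto_intros v) simp
  ultimately show "(\<lambda>n. char (?\<mu> n) s)
      \<longlonglongrightarrow> char (distr std_normal_distribution borel (\<lambda>x. \<sigma> * x)) s"
    unfolding char_scaled_normal by (rule Lim_transform[rotated])
qed

text \<open>The two Skorohod representations live on unrelated spaces. Their product carries the
  product laws, for each n and in the limit, and there both coordinates converge pointwise;
  continuity of \<open>h\<close> passes this to the pair, and boundedness allows dominated
  convergence.\<close>

lemma weak_conv_m_pair:
  fixes h :: "real \<times> real \<Rightarrow> real"
  assumes \<mu>: "\<And>n. real_distribution (\<mu> n)" "real_distribution \<mu>'" "weak_conv_m \<mu> \<mu>'"
    and \<nu>: "\<And>n. real_distribution (\<nu> n)" "real_distribution \<nu>'" "weak_conv_m \<nu> \<nu>'"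
    and h: "continuous_on UNIV h" "bounded (range h)"
  shows "(\<lambda>n. integral\<^sup>L (\<mu> n \<Otimes>\<^sub>M \<nu> n) h) \<longlonglongrightarrow> integral\<^sup>L (\<mu>' \<Otimes>\<^sub>M \<nu>') h"
proof -
  obtain \<Omega> :: "real measure" and Y Y' where "prob_space \<Omega>"
    and Y[measurable]: "\<And>n. Y n \<in> measurable \<Omega> borel" and dY: "\<And>n. distr \<Omega> borel (Y n) = \<mu> n"
    and Y'0: "Y' \<in> measurable \<Omega> lborel" and dY': "distr \<Omega> borel Y' = \<mu>'"
    and Ylim: "\<And>x. x \<in> space \<Omega> \<Longrightarrow> (\<lambda>n. Y n x) \<longlonglongrightarrow> Y' x"
    using Skorohod[OF \<mu>] by metis
  obtain \<Omega>' :: "real measure" and Z Z' where "prob_space \<Omega>'"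
    and Z[measurable]: "\<And>n. Z n \<in> measurable \<Omega>' borel" and dZ: "\<And>n. distr \<Omega>' borel (Z n) = \<nu> n"
    and Z'0: "Z' \<in> measurable \<Omega>' lborel" and dZ': "distr \<Omega>' borel Z' = \<nu>'"
    and Zlim: "\<And>x. x \<in> space \<Omega>' \<Longrightarrow> (\<lambda>n. Z n x) \<longlonglongrightarrow> Z' x"
    using Skorohod[OF \<nu>] by metis
  interpret \<Omega>: prob_space \<Omega> by fact
  interpret \<Omega>': prob_space \<Omega>' by fact
  interpret P: pair_prob_space \<Omega> \<Omega>' ..
  have Y'[measurable]: "Y' \<in> borel_measurable \<Omega>" and Z'[measurable]: "Z' \<in> borel_measurable \<Omega>'"
    using Y'0 Z'0 by simp_all
  have hm[measurable]: "h \<in> borel_measurable (borel \<Otimes>\<^sub>M borel)"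
    unfolding borel_prod by (rule borel_measurable_continuous_onI[OF h(1)])
  obtain C where C: "\<And>x. \<bar>h x\<bar> \<le> C"
    using h(2) unfolding bounded_iff by (metis rangeI real_norm_def)
  have pair: "integral\<^sup>L (distr \<Omega> borel A \<Otimes>\<^sub>M distr \<Omega>' borel B) h
      = (\<integral>z. h (A (fst z), B (snd z)) \<partial>(\<Omega> \<Otimes>\<^sub>M \<Omega>'))"
    if [measurable]: "A \<in> borel_measurable \<Omega>" "B \<in> borel_measurable \<Omega>'" for A B
  proof -
    interpret B: prob_space "distr \<Omega>' borel B" by (rule \<Omega>'.prob_space_distr) measurable
    have "distr \<Omega> borel A \<Otimes>\<^sub>M distr \<Omega>' borel B
        = distr (\<Omega> \<Otimes>\<^sub>M \<Omega>') (borel \<Otimes>\<^sub>M borel) (\<lambda>(x, y). (A x, B y))"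
      by (rule pair_measure_distr) (auto intro: B.sigma_finite_measure_axioms)
    then show ?thesis by (simp add: integral_distr split_beta)
  qed
  have "(\<lambda>n. \<integral>z. h (Y n (fst z), Z n (snd z)) \<partial>(\<Omega> \<Otimes>\<^sub>M \<Omega>'))
      \<longlonglongrightarrow> (\<integral>z. h (Y' (fst z), Z' (snd z)) \<partial>(\<Omega> \<Otimes>\<^sub>M \<Omega>'))"
  proof (rule integral_dominated_convergence[where w = "\<lambda>_. C"])
    show "AE z in \<Omega> \<Otimes>\<^sub>M \<Omega>'. (\<lambda>n. h (Y n (fst z), Z n (snd z))) \<longlonglongrightarrow> h (Y' (fst z), Z' (snd z))"
    proof (rule AE_I2)
      fix z assume z: "z \<in> space (\<Omega> \<Otimes>\<^sub>M \<Omega>')"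
      have "isCont h (Y' (fst z), Z' (snd z))"
        using h(1) by (simp add: continuous_on_eq_continuous_at)
      then show "(\<lambda>n. h (Y n (fst z), Z n (snd z))) \<longlonglongrightarrow> h (Y' (fst z), Z' (snd z))"
        by (rule isCont_tendsto_compose)
          (use z in \<open>auto intro!: tendsto_Pair Ylim Zlim simp: space_pair_measure\<close>)
    qed
  qed (use C in auto)
  then show ?thesis
    unfolding dY[symmetric] dZ[symmetric] dY'[symmetric] dZ'[symmetric]
    by (subst (1 2) pair) measurable
qed

section \<open>The current status sample\<close>

lemma has_lebesgue_density_real_distribution:
  assumes "has_lebesgue_density F f"
  shows "real_distribution (density lborel (\<lambda>x. ennreal (f x)))"
  using assms by (simp add: has_lebesgue_density_def real_distribution_def real_distribution_axioms_def)

text \<open>Serves two purposes: for \<open>F\<close> it separates the values at neighbouring grid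
  points, for \<open>G\<close> it bounds the mass of a site from below.\<close>

lemma cdf_increment_ge:
  assumes F: "has_lebesgue_density F f"
    and xy: "x \<le> y" and m: "0 \<le> m" "\<And>z. z \<in> {x..y} \<Longrightarrow> m \<le> f z"
  shows "m * (y - x) \<le> F y - F x"
proof (cases "x = y")
  case False
  let ?D = "density lborel (\<lambda>x. ennreal (f x))"
  have [measurable]: "f \<in> borel_measurable borel" and D: "prob_space ?D" and Fc: "F = cdf ?D"
    using F by (auto simp: has_lebesgue_density_def)
  interpret D: prob_space ?D by (rule D)
  interpret R: real_distribution ?D by (rule has_lebesgue_density_real_distribution[OF F])
  have "ennreal (m * (y - x)) = (\<integral>\<^sup>+z. ennreal m * indicator {x<..y} z \<partial>lborel)"
    using m xy by (simp add: nn_integral_cmult ennreal_mult)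
  also have "\<dots> \<le> (\<integral>\<^sup>+z. ennreal (f z) * indicator {x<..y} z \<partial>lborel)"
    by (intro nn_integral_mono) (auto simp: indicator_def intro!: ennreal_leI m)
  also have "\<dots> = emeasure ?D {x<..y}"
    by (subst emeasure_density) auto
  finally have "m * (y - x) \<le> measure ?D {x<..y}"
    by (simp add: D.emeasure_eq_measure)
  also have "\<dots> = F y - F x"
    unfolding Fc using False xy by (intro R.cdf_diff_eq[symmetric]) simp
  finally show ?thesis .
qed simp

lemma has_lebesgue_density_bounds:
  assumes F: "has_lebesgue_density F f"
  shows "0 \<le> F x" "F x \<le> 1"
proof -
  interpret R: real_distribution "density lborel (\<lambda>x. ennreal (f x))"
    by (rule has_lebesgue_density_real_distribution[OF F])
  show "0 \<le> F x" "F x \<le> 1"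
    using F R.cdf_nonneg R.cdf_bounded_prob by (auto simp: has_lebesgue_density_def)
qed

text \<open>The mass function inside \<open>grid_law\<close>, named for reuse. The end points also
  absorb the mass of \<open>G\<close> outside the grid, so each weight dominates an increment of
  \<open>G\<close> over one cell.\<close>

definition grid_weight :: "(real \<Rightarrow> real) \<Rightarrow> nat \<Rightarrow> (nat \<Rightarrow> real) \<Rightarrow> nat \<Rightarrow> real" where
  "grid_weight G K t i =
     (if i = 1 then G (t 1) else if i = K then 1 - G (t (K - 1)) else G (t i) - G (t (i - 1)))"

lemma emeasure_grid_law:
  assumes "inj_on t {1..K}" and i: "i \<in> {1..K}"
  shows "emeasure (grid_law G K t) {t i} = ennreal (grid_weight G K t i)"
proof -
  have "t -` {t i} \<inter> {1..K} = {i}"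
    using assms by (auto dest: inj_onD)
  then show ?thesis
    unfolding grid_law_def
    by (subst emeasure_distr)
      (use i in \<open>auto simp: space_point_measure emeasure_point_measure_finite2 grid_weight_def\<close>)
qed

text \<open>One row of the array. The law \<open>H\<close> stays abstract: the estimates see it only
  through the masses \<open>measure H {s}\<close>, and the grid enters later through a lower bound
  for them.\<close>

locale current_status = prob_space M for M :: "'w measure" +
  fixes n :: nat and F f :: "real \<Rightarrow> real" and H :: "real measure"
    and T X :: "nat \<Rightarrow> 'w \<Rightarrow> real"
  assumes density: "has_lebesgue_density F f"
    and sample: "current_status_sample M n f H T X"
begin

lemma T_rv[measurable]: "j \<in> {1..n} \<Longrightarrow> T j \<in> borel_measurable M"
  and X_rv[measurable]: "j \<in> {1..n} \<Longrightarrow> X j \<in> borel_measurable M"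
  using sample by (auto simp: current_status_sample_def distributed_def)

lemma X_distr: "j \<in> {1..n} \<Longrightarrow> distr M borel (X j) = H"
  using sample by (auto simp: current_status_sample_def)

lemma indep_TX: "indep_vars (\<lambda>_. borel) (case_sum T X) ({1..n} <+> {1..n})"
  using sample by (auto simp: current_status_sample_def)

lemma T_distr: "j \<in> {1..n} \<Longrightarrow> distr M lborel (T j) = density lborel (\<lambda>x. ennreal (f x))"
  using sample by (auto simp: current_status_sample_def distributed_def)

lemma prob_T_le:
  assumes j: "j \<in> {1..n}"
  shows "prob {\<omega> \<in> space M. T j \<omega> \<le> s} = F s"
proof -
  have "measure (density lborel (\<lambda>x. ennreal (f x))) {..s} = measure (distr M lborel (T j)) {..s}"
    by (simp add: T_distr[OF j])
  also have "\<dots> = prob {\<omega> \<in> space M. T j \<omega> \<le> s}"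
    using T_rv[OF j] by (subst measure_distr) (auto intro!: arg_cong[where f = prob])
  finally show ?thesis
    using density by (simp add: has_lebesgue_density_def cdf_def)
qed

text \<open>The threshold is the fixed point \<open>s\<close> and not \<open>X j\<close>. Where
  \<open>X j \<omega> = s\<close> this is the centred current status indicator, yet it is a function
  of \<open>T j\<close> alone and therefore independent of the second sample.\<close>

definition resid :: "real \<Rightarrow> nat \<Rightarrow> 'w \<Rightarrow> real" where
  "resid s j \<omega> = of_bool (T j \<omega> \<le> s) - F s"

lemma resid_rv[measurable]: "j \<in> {1..n} \<Longrightarrow> resid s j \<in> borel_measurable M"
  unfolding resid_def of_bool_def by measurable

lemma abs_resid_le: "\<bar>resid s j \<omega>\<bar> \<le> 1"
  using has_lebesgue_density_bounds[OF density, of s] by (auto simp: resid_def)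

lemma integrable_of_bool_T: "j \<in> {1..n} \<Longrightarrow> integrable M (\<lambda>\<omega>. of_bool (T j \<omega> \<le> s) :: real)"
  by (rule integrable_const_bound[where B = 1]) (auto simp: of_bool_def)

lemma integral_of_bool_T:
  assumes "j \<in> {1..n}"
  shows "(\<integral>\<omega>. of_bool (T j \<omega> \<le> s) \<partial>M) = F s"
proof -
  have "(\<integral>\<omega>. of_bool (T j \<omega> \<le> s) \<partial>M) = (\<integral>\<omega>. indicator {\<omega> \<in> space M. T j \<omega> \<le> s} \<omega> \<partial>M)"
    by (intro Bochner_Integration.integral_cong) auto
  also have "\<dots> = prob ({\<omega> \<in> space M. T j \<omega> \<le> s} \<inter> space M)"
    by (rule Bochner_Integration.integral_indicator)
  also have "\<dots> = F s"
    using prob_T_le[OF assms, of s] by (simp add: Int_absorb2)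
  finally show ?thesis .
qed

lemma integral_resid: "j \<in> {1..n} \<Longrightarrow> (\<integral>\<omega>. resid s j \<omega> \<partial>M) = 0"
  unfolding resid_def
  by (simp add: integrable_of_bool_T integral_of_bool_T prob_space)

lemma integral_resid_square:
  assumes "j \<in> {1..n}"
  shows "(\<integral>\<omega>. (resid s j \<omega>)\<^sup>2 \<partial>M) = F s * (1 - F s)"
proof -
  \<comment> \<open>An indicator is its own square, so the squared residual is affine in it.\<close>
  have "(\<lambda>\<omega>. (resid s j \<omega>)\<^sup>2) = (\<lambda>\<omega>. (1 - 2 * F s) * of_bool (T j \<omega> \<le> s) + (F s)\<^sup>2)"
    by (auto simp: resid_def power2_eq_square algebra_simps)
  then show ?thesis
    using assms
    by (simp add: integrable_of_bool_T integral_of_bool_T prob_space power2_eq_square algebra_simps)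
qed

text \<open>The pattern behind the later independence claims as well: the joint family
  \<open>case_sum T X\<close> is split into disjoint blocks of indices, the restrictions to the
  blocks are independent, and each variable of interest is a measurable function of its
  block.\<close>

lemma indep_resid: "J \<subseteq> {1..n} \<Longrightarrow> indep_vars (\<lambda>_. borel) (resid s) J"
proof -
  assume J: "J \<subseteq> {1..n}"
  have "indep_vars (\<lambda>j. PiM {Inl j} (\<lambda>_. borel))
      (\<lambda>j \<omega>. restrict (\<lambda>i. case_sum T X i \<omega>) {Inl j}) J"
    using J by (intro indep_vars_restrict[OF indep_TX]) (auto simp: disjoint_family_on_def)
  from indep_vars_compose2[OF this, where Y = "\<lambda>j x. of_bool (x (Inl j) \<le> s) - F s"
      and N = "\<lambda>_. borel"]
  show ?thesis by (simp add: resid_def[abs_def] of_bool_def)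
qed

end

section \<open>Exponential bounds\<close>

lemma exp_le_quadratic:
  fixes x :: real
  assumes "\<bar>x\<bar> \<le> 1"
  shows "exp x \<le> 1 + x + x\<^sup>2"
proof (cases "0 \<le> x")
  case True
  with assms show ?thesis by (intro exp_bound) auto
next
  case False
  with exp_minus_approx[of "- x"] show ?thesis by simp
qed

text \<open>Converts an exponential moment \<open>exp (- y)\<close> into the form
  \<open>1 - d\<close> with \<open>d = y / 2\<close>, as \<open>prob_site_product_ge\<close>
  requires.\<close>

lemma one_minus_exp_ge:
  fixes y :: real
  assumes "0 \<le> y" "y \<le> 1"
  shows "y / 2 \<le> 1 - exp (- y)"
proof -
  have "exp (- y) \<le> 1 / (1 + y)"
    using exp_ge_add_one_self[of y] assms by (simp add: exp_minus field_simps)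
  also have "\<dots> \<le> 1 - y / 2"
    using mult_left_mono[OF assms(2) assms(1)] assms by (simp add: field_simps)
  finally show ?thesis by simp
qed

lemma one_minus_power_le_exp:
  fixes p :: real
  assumes "0 \<le> p" "p \<le> 1" "0 \<le> d" "d \<le> 1"
  shows "(1 - p * d) ^ n \<le> exp (- (n * p * d))"
proof -
  have "p * d \<le> 1" using assms by (simp add: mult_le_one)
  then have "(1 - p * d) ^ n \<le> exp (- (p * d)) ^ n"
    using exp_ge_add_one_self[of "- (p * d)"] by (intro power_mono) auto
  also have "\<dots> = exp (- (n * p * d))"
    by (simp add: exp_of_nat_mult[symmetric] algebra_simps)
  finally show ?thesis .
qed

context current_status
begin

section \<open>Moments and tails of products over the observations at one site\<close>

lemma prob_X_eq:
  assumes j: "j \<in> {1..n}"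
  shows "prob {\<omega> \<in> space M. X j \<omega> = s} = measure H {s}"
  using X_distr[OF j] X_rv[OF j]
  by (auto simp: measure_distr vimage_def Int_def conj_commute dest!: sym[of _ H])

text \<open>The factor for \<open>j\<close> depends on the pair \<open>T j\<close>,
  \<open>X j\<close> only, so the factors are independent. Each factor is
  \<open>1 - I + I * u (T j \<omega>)\<close>, where the indicator \<open>I\<close> of an
  observation at \<open>s\<close> is independent of \<open>T j\<close>. For constant
  \<open>u\<close> this is the generating function of the binomial count.\<close>

lemma expectation_site_product:
  assumes [measurable]: "u \<in> borel_measurable borel"
    and bdd: "\<And>x. \<bar>u x\<bar> \<le> C"
    and e: "\<And>j. j \<in> {1..n} \<Longrightarrow> (\<integral>\<omega>. u (T j \<omega>) \<partial>M) = e"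
  shows "(\<integral>\<omega>. (\<Prod>j\<in>{1..n}. if X j \<omega> = s then u (T j \<omega>) else 1) \<partial>M)
           = (1 - measure H {s} + measure H {s} * e) ^ n"
proof -
  define D where "D j \<omega> = (if X j \<omega> = s then u (T j \<omega>) else 1)" for j \<omega>
  have [measurable]: "D j \<in> borel_measurable M" if "j \<in> {1..n}" for j
    using T_rv[OF that, measurable] X_rv[OF that, measurable] unfolding D_def by measurable
  have D_int: "integrable M (D j)" if "j \<in> {1..n}" for j
    using that bdd by (intro integrable_const_bound[where B = "max C 1"])
      (auto simp: D_def le_max_iff_disj)
  have "indep_vars (\<lambda>j. PiM {Inl j, Inr j} (\<lambda>_. borel))
      (\<lambda>j \<omega>. restrict (\<lambda>i. case_sum T X i \<omega>) {Inl j, Inr j}) {1..n}"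
    by (intro indep_vars_restrict[OF indep_TX]) (auto simp: disjoint_family_on_def)
  from indep_vars_compose2[OF this, where N = "\<lambda>_. borel"
      and Y = "\<lambda>j x. if x (Inr j) = s then u (x (Inl j)) else 1"]
  have "indep_vars (\<lambda>_. borel) D {1..n}"
    by (simp add: D_def[abs_def] cong: if_cong)
  then have "(\<integral>\<omega>. (\<Prod>j\<in>{1..n}. D j \<omega>) \<partial>M) = (\<Prod>j\<in>{1..n}. integral\<^sup>L M (D j))"
    by (intro indep_vars_lebesgue_integral D_int) auto
  also have "\<dots> = (\<Prod>j\<in>{1..n}. 1 - measure H {s} + measure H {s} * e)"
  proof (rule prod.cong[OF refl])
    fix j assume j: "j \<in> {1..n}"
    note T_rv[OF j, measurable] X_rv[OF j, measurable]
    define I :: "'w \<Rightarrow> real" where "I \<omega> = of_bool (X j \<omega> = s)" for \<omega>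
    have [measurable]: "I \<in> borel_measurable M" unfolding I_def of_bool_def by measurable
    have I_int: "integrable M I"
      by (rule integrable_const_bound[where B = 1]) (auto simp: I_def)
    have u_int: "integrable M (\<lambda>\<omega>. u (T j \<omega>))"
      using bdd by (intro integrable_const_bound[where B = C]) auto
    have "integral\<^sup>L M I = (\<integral>\<omega>. indicator {\<omega> \<in> space M. X j \<omega> = s} \<omega> \<partial>M)"
      by (intro Bochner_Integration.integral_cong) (auto simp: I_def)
    also have "\<dots> = prob ({\<omega> \<in> space M. X j \<omega> = s} \<inter> space M)"
      by (rule Bochner_Integration.integral_indicator)
    finally have I: "integral\<^sup>L M I = measure H {s}"
      using prob_X_eq[OF j] by (simp add: Int_absorb2)
    have "indep_var (PiM {Inr j} (\<lambda>_. borel)) (\<lambda>\<omega>. restrict (\<lambda>i. case_sum T X i \<omega>) {Inr j})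
        (PiM {Inl j} (\<lambda>_. borel)) (\<lambda>\<omega>. restrict (\<lambda>i. case_sum T X i \<omega>) {Inl j})"
      using j by (intro indep_var_restrict[OF indep_TX]) auto
    from indep_var_compose[OF this, where ?N1.0 = borel and ?N2.0 = borel
        and ?Y1.0 = "\<lambda>x. of_bool (x (Inr j) = s) :: real" and ?Y2.0 = "\<lambda>x. u (x (Inl j))"]
    have iv: "indep_var borel I borel (\<lambda>\<omega>. u (T j \<omega>))"
      by (simp add: I_def[abs_def] comp_def of_bool_def)
    have "integral\<^sup>L M (D j) = (\<integral>\<omega>. 1 - I \<omega> + I \<omega> * u (T j \<omega>) \<partial>M)"
      by (intro Bochner_Integration.integral_cong) (auto simp: D_def I_def)
    also have "\<dots> = 1 - measure H {s} + measure H {s} * e"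
      using indep_var_integrable[OF iv I_int u_int] indep_var_lebesgue_integral[OF iv I_int u_int]
        I_int e[OF j] by (simp add: I prob_space)
    finally show "integral\<^sup>L M (D j) = 1 - measure H {s} + measure H {s} * e" .
  qed
  finally show ?thesis by (simp add: D_def)
qed

text \<open>The index set is recorded instead of its size, because conditioning on it turns residual
  sums into sums over a fixed set of independent variables.\<close>

definition sites :: "real \<Rightarrow> 'w \<Rightarrow> nat set" where
  "sites s \<omega> = {j \<in> {1..n}. X j \<omega> = s}"

lemma finite_sites[simp]: "finite (sites s \<omega>)"
  by (simp add: sites_def)

lemma pred_sites[measurable (raw)]:
  assumes "A \<subseteq> {1..n}"
  shows "Measurable.pred M (\<lambda>\<omega>. sites s \<omega> = A)"
proof -
  have "sites s \<omega> = A \<longleftrightarrow> (\<forall>j\<in>{1..n}. X j \<omega> = s \<longleftrightarrow> j \<in> A)" for \<omega>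
    using assms by (auto simp: sites_def)
  then show ?thesis by simp measurable
qed

text \<open>Only finitely many values occur, so it suffices to check single values. With the
  discrete target every function of the index set is measurable.\<close>

lemma sites_measurable[measurable]: "sites s \<in> M \<rightarrow>\<^sub>M count_space UNIV"
proof -
  have "sites s -` {A} \<inter> space M \<in> sets M" if "A \<subseteq> {1..n}" for A
  proof -
    have "sites s -` {A} \<inter> space M = {\<omega> \<in> space M. sites s \<omega> = A}" by auto
    then show ?thesis using pred_sites[OF that] by (simp add: pred_def)
  qed
  moreover have "sites s \<omega> \<subseteq> {1..n}" for \<omega> by (auto simp: sites_def)
  ultimately have "sites s \<in> M \<rightarrow>\<^sub>M count_space (Pow {1..n})"
    by (subst measurable_count_space_eq2) auto
  then show ?thesis
    by (rule measurable_compose) simp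
qed

lemma site_sum_measurable[measurable]:
  "(\<lambda>\<omega>. \<Sum>j\<in>sites s \<omega>. resid s j \<omega>) \<in> borel_measurable M"
proof -
  \<comment> \<open>The random index set is traded for a fixed one, with zero terms away from the
    site.\<close>
  have "(\<lambda>\<omega>. \<Sum>j\<in>sites s \<omega>. resid s j \<omega>) = (\<lambda>\<omega>. \<Sum>j\<in>{1..n}. if X j \<omega> = s then resid s j \<omega> else 0)"
    unfolding sites_def by (subst sum.inter_filter) auto
  then show ?thesis by simp
qed

text \<open>Markov's inequality for the product. Its mean is at most \<open>(1 - p * d) ^ n\<close>
  with p the mass of the site, since a factor at the site has mean at most \<open>1 - d\<close> and
  a factor elsewhere is 1. This is the common source of the bounds for counts and for
  deviations.\<close>

lemma prob_site_product_ge: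
  assumes u[measurable]: "u \<in> borel_measurable borel"
    and bdd: "\<And>x. 0 \<le> u x" "\<And>x. u x \<le> C"
    and e: "\<And>j. j \<in> {1..n} \<Longrightarrow> (\<integral>\<omega>. u (T j \<omega>) \<partial>M) = e" "e \<le> 1 - d" and d: "0 \<le> d" "d \<le> 1"
    and c: "0 < c"
  shows "prob {\<omega> \<in> space M. c \<le> (\<Prod>j\<in>sites s \<omega>. u (T j \<omega>))}
    \<le> exp (- (n * measure H {s} * d)) / c"
proof (cases "n = 0")
  case True
  then have "prob {\<omega> \<in> space M. c \<le> (\<Prod>j\<in>sites s \<omega>. u (T j \<omega>))} = prob {\<omega> \<in> space M. c \<le> 1}"
    unfolding sites_def by simp
  also have "\<dots> \<le> 1 / c"
    using c by (cases "c \<le> 1") (auto simp: prob_space)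
  finally show ?thesis using True by simp
next
  case False
  \<comment> \<open>The first observation certifies that \<open>measure H {s}\<close> lies in the
    unit interval and that \<open>e\<close> is nonnegative.\<close>
  then have "1 \<in> {1..n}" by simp
  note one = prob_X_eq[OF this, of s] e(1)[OF this]
  have p: "0 \<le> measure H {s}" "measure H {s} \<le> 1"
    using one(1) by (auto simp flip: one(1))
  have e0: "0 \<le> e" using one(2) bdd by (metis Bochner_Integration.integral_nonneg)
  let ?W = "\<lambda>\<omega>. \<Prod>j\<in>{1..n}. if X j \<omega> = s then u (T j \<omega>) else 1"
  have W: "(\<Prod>j\<in>sites s \<omega>. u (T j \<omega>)) = ?W \<omega>" for \<omega>
    unfolding sites_def by (subst prod.inter_filter) auto
  have [measurable]: "?W \<in> borel_measurable M"
    using T_rv X_rv by measurable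
  have C: "0 \<le> C" using bdd[of 0] by linarith
  have "integrable M ?W"
  proof (rule integrable_const_bound[where B = "max C 1 ^ n"])
    have "?W \<omega> \<le> (\<Prod>j\<in>{1..n}. max C 1)" for \<omega>
      using bdd by (intro prod_mono) (auto simp: le_max_iff_disj)
    then show "AE \<omega> in M. norm (?W \<omega>) \<le> max C 1 ^ n"
      using bdd by (auto simp: prod_nonneg abs_of_nonneg)
  qed simp
  then have "prob {\<omega> \<in> space M. c \<le> ?W \<omega>} \<le> integral\<^sup>L M ?W / c"
    using bdd c by (intro integral_Markov_inequality_measure[where A = "{}"])
     (auto intro!: prod_nonneg)
  also have "\<dots> = (1 - measure H {s} + measure H {s} * e) ^ n / c"
    using bdd e by (subst expectation_site_product[where C = C]) auto
  also have "\<dots> \<le> (1 - measure H {s} * d) ^ n / c"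
    using p c mult_left_mono[OF e(2) p(1)] mult_nonneg_nonneg[OF p(1) e0]
    by (intro divide_right_mono power_mono) (auto simp: algebra_simps)
  also have "\<dots> \<le> exp (- (n * measure H {s} * d)) / c"
    using p c d by (intro divide_right_mono one_minus_power_le_exp) auto
  finally show ?thesis unfolding W .
qed

text \<open>A Chernoff bound for the lower tail: with the constant factor \<open>exp (- 1)\<close>
  the product is \<open>exp\<close> of minus the count, and \<open>1 - exp (- 1)\<close> is at least
  1/2.\<close>

lemma prob_card_sites_le:
  "prob {\<omega> \<in> space M. card (sites s \<omega>) \<le> k} \<le> exp k * exp (- (n * measure H {s} / 2))"
proof -
  have "{\<omega> \<in> space M. card (sites s \<omega>) \<le> k}
      = {\<omega> \<in> space M. exp (- real k) \<le> (\<Prod>j\<in>sites s \<omega>. exp (- 1))}"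
    by (auto simp: exp_of_nat_mult[symmetric])
  also have "prob \<dots> \<le> exp (- (n * measure H {s} * (1 / 2))) / exp (- real k)"
    using one_minus_exp_ge[of 1]
    by (intro prob_site_product_ge[where C = 1 and e = "exp (- 1)"]) (auto simp: prob_space)
  finally show ?thesis by (simp add: exp_minus field_simps)
qed

text \<open>Putting the random threshold \<open>\<theta> * card (sites s \<omega>)\<close> inside the exponential moment avoids
  conditioning on the counts. The event contains that of an empty site, where both sides are 0.\<close>

lemma prob_site_sum_ge:
  fixes \<theta> \<epsilon> :: real
  assumes \<theta>: "0 \<le> \<theta>" "\<theta> \<le> 1" and \<epsilon>: "\<bar>\<epsilon>\<bar> = 1"
  shows "prob {\<omega> \<in> space M. \<theta> * card (sites s \<omega>) \<le> \<epsilon> * (\<Sum>j\<in>sites s \<omega>. resid s j \<omega>)}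
    \<le> exp (- (n * measure H {s} * \<theta>\<^sup>2 / 8))"
\<comment> \<open>In the degenerate cases the right-hand side is 1.\<close>
proof (cases "n = 0 \<or> \<theta> = 0")
  case True
  then show ?thesis by auto
next
  case False
  then have \<theta>0: "0 < \<theta>" and n: "1 \<in> {1..n}" using \<theta> by auto
  \<comment> \<open>The tilt minimizes \<open>\<kappa>\<^sup>2 - \<kappa> * \<theta>\<close>, with
    minimum \<open>- (\<theta>\<^sup>2 / 4)\<close>.\<close>
  define \<kappa> where "\<kappa> = \<theta> / 2"
  \<comment> \<open>Each observation at the site contributes its signed residual minus its share
    \<open>\<theta>\<close> of the threshold; \<open>\<epsilon>\<close> is the sign that selects the
    tail.\<close>
  define u where "u x = exp (\<kappa> * (\<epsilon> * (of_bool (x \<le> s) - F s) - \<theta>))" for x :: real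
  have u_meas[measurable]: "u \<in> borel_measurable borel"
    unfolding u_def of_bool_def by measurable
  have eps2: "\<epsilon>\<^sup>2 = 1" using \<epsilon> by (metis power2_abs power_one)
  have u_T: "u (T j \<omega>) = exp (- (\<kappa> * \<theta>)) * exp (\<kappa> * (\<epsilon> * resid s j \<omega>))" for j \<omega>
    by (simp add: u_def resid_def exp_add[symmetric] algebra_simps)
  have small: "\<bar>\<kappa> * (\<epsilon> * resid s j \<omega>)\<bar> \<le> 1" for j \<omega>
    using \<theta> \<epsilon> mult_le_one[OF \<theta>(2) abs_ge_zero abs_resid_le[of s j \<omega>]]
    by (simp add: \<kappa>_def abs_mult)
  have E: "(\<integral>\<omega>. u (T j \<omega>) \<partial>M) \<le> 1 - \<theta>\<^sup>2 / 8" if j: "j \<in> {1..n}" for j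
  proof -
    have [simp]: "integrable M (resid s j)"
      using j abs_resid_le by (intro integrable_const_bound[where B = 1]) auto
    have [simp]: "integrable M (\<lambda>\<omega>. exp (\<kappa> * (\<epsilon> * resid s j \<omega>)))"
      using j small[of j] by (intro integrable_const_bound[where B = "exp 1"])
        (auto simp: abs_le_iff)
    have "exp (\<kappa> * (\<epsilon> * resid s j \<omega>)) \<le> 1 + \<kappa> * \<epsilon> * resid s j \<omega> + \<kappa>\<^sup>2" for \<omega>
    proof -
      have "(\<kappa> * (\<epsilon> * resid s j \<omega>))\<^sup>2 \<le> \<kappa>\<^sup>2"
        using abs_resid_le[of s j \<omega>] eps2
        by (simp add: power_mult_distrib mult_left_le abs_square_le_1)
      then show ?thesis using exp_le_quadratic[OF small[of j \<omega>]] by simp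
    qed
    then have "(\<integral>\<omega>. exp (\<kappa> * (\<epsilon> * resid s j \<omega>)) \<partial>M) \<le> (\<integral>\<omega>. 1 + \<kappa> * \<epsilon> * resid s j \<omega> + \<kappa>\<^sup>2 \<partial>M)"
      by (intro integral_mono) auto
    also have "\<dots> = 1 + \<kappa>\<^sup>2" using integral_resid[OF j, of s] by (simp add: prob_space)
    also have "\<dots> \<le> exp (\<kappa>\<^sup>2)" by (rule exp_ge_add_one_self)
    finally have "(\<integral>\<omega>. u (T j \<omega>) \<partial>M) \<le> exp (- (\<kappa> * \<theta>)) * exp (\<kappa>\<^sup>2)"
      unfolding u_T by simp
    also have "\<dots> = exp (- (\<theta>\<^sup>2 / 4))"
      by (simp add: \<kappa>_def exp_add[symmetric] power2_eq_square)
    \<comment> \<open>The constant 8 arises here: half of \<open>\<theta>\<^sup>2 / 4\<close> is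
      what \<open>one_minus_exp_ge\<close> retains.\<close>
    also have "\<dots> \<le> 1 - \<theta>\<^sup>2 / 8"
      using one_minus_exp_ge[of "\<theta>\<^sup>2 / 4"] \<theta> abs_square_le_1[of \<theta>] by simp
    finally show ?thesis .
  qed
  \<comment> \<open>The product bound asks for one moment \<open>e\<close> common to all indices;
    the moment for index 1 represents it.\<close>
  have same_law: "(\<integral>\<omega>. u (T j \<omega>) \<partial>M) = (\<integral>\<omega>. u (T 1 \<omega>) \<partial>M)" if j: "j \<in> {1..n}" for j
  proof -
    have "(\<integral>\<omega>. u (T i \<omega>) \<partial>M) = (\<integral>x. u x \<partial>density lborel (\<lambda>x. ennreal (f x)))"
      if i: "i \<in> {1..n}" for i
      using T_rv[OF i] by (simp add: integral_distr flip: T_distr[OF i])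
    from this[OF j] this[OF n] show ?thesis by simp
  qed
  have "{\<omega> \<in> space M. \<theta> * card (sites s \<omega>) \<le> \<epsilon> * (\<Sum>j\<in>sites s \<omega>. resid s j \<omega>)}
      = {\<omega> \<in> space M. 1 \<le> (\<Prod>j\<in>sites s \<omega>. u (T j \<omega>))}"
  proof -
    have "(\<Prod>j\<in>sites s \<omega>. u (T j \<omega>))
        = exp (\<kappa> * (\<epsilon> * (\<Sum>j\<in>sites s \<omega>. resid s j \<omega>) - \<theta> * card (sites s \<omega>)))" for \<omega>
    proof -
      have "(\<Prod>j\<in>sites s \<omega>. u (T j \<omega>)) = exp (\<Sum>j\<in>sites s \<omega>. \<kappa> * (\<epsilon> * resid s j \<omega> - \<theta>))"
        by (simp add: exp_sum u_def resid_def)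
      then show ?thesis
        by (simp add: sum_distrib_left[symmetric] sum_subtractf mult.commute[of \<theta>])
    qed
    moreover have "0 < \<kappa>" using \<theta>0 by (simp add: \<kappa>_def)
    ultimately show ?thesis by (simp add: zero_le_mult_iff)
  qed
  also have "prob \<dots> \<le> exp (- (n * measure H {s} * (\<theta>\<^sup>2 / 8))) / 1"
  proof (rule prob_site_product_ge[where C = "exp 1"])
    show "u x \<le> exp 1" for x
    proof -
      have "\<bar>\<epsilon> * (of_bool (x \<le> s) - F s)\<bar> \<le> 1"
        using \<epsilon> has_lebesgue_density_bounds[OF density, of s] by (auto simp: abs_mult)
      then have "\<epsilon> * (of_bool (x \<le> s) - F s) - \<theta> \<le> 1"
        using \<theta> by linarith
      then have "\<kappa> * (\<epsilon> * (of_bool (x \<le> s) - F s) - \<theta>) \<le> \<kappa> * 1"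
        using \<theta> by (intro mult_left_mono) (auto simp: \<kappa>_def)
      also have "\<dots> \<le> 1" using \<theta> by (simp add: \<kappa>_def)
      finally show ?thesis by (simp add: u_def)
    qed
    show "(\<integral>\<omega>. u (T 1 \<omega>) \<partial>M) \<le> 1 - \<theta>\<^sup>2 / 8" by (rule E[OF n])
    show "\<theta>\<^sup>2 / 8 \<le> 1" "0 \<le> \<theta>\<^sup>2 / 8" using \<theta> abs_square_le_1[of \<theta>] by simp_all
    show "0 \<le> u x" for x by (simp add: u_def)
  qed (fact u_meas, fact same_law, simp)
  finally show ?thesis by simp
qed

end

section \<open>Conditioning on the observation sites\<close>

context current_status
begin

text \<open>For empty \<open>J\<close> the value is 0, by division by 0. This agrees with the
  standardized error at an unobserved site, whose factor \<open>sqrt 0\<close> vanishes.\<close>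

definition std_resid :: "real \<Rightarrow> nat set \<Rightarrow> 'w \<Rightarrow> real" where
  "std_resid s J \<omega> = (\<Sum>j\<in>J. resid s j \<omega>) / sqrt (card J)"

lemma std_resid_rv[measurable (raw)]: "J \<subseteq> {1..n} \<Longrightarrow> std_resid s J \<in> borel_measurable M"
  unfolding std_resid_def
  by (intro borel_measurable_divide borel_measurable_sum borel_measurable_const resid_rv) auto

text \<open>Disjoint \<open>A\<close> and \<open>B\<close> use disjoint blocks of the first sample,
  so the joint law is the product law.\<close>

lemma integral_std_resid_pair:
  fixes h :: "real \<times> real \<Rightarrow> real"
  assumes A: "A \<subseteq> {1..n}" and B: "B \<subseteq> {1..n}" and AB: "A \<inter> B = {}"
    and [measurable]: "h \<in> borel_measurable borel"
  shows "(\<integral>\<omega>. h (std_resid s A \<omega>, std_resid s' B \<omega>) \<partial>M)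
    = integral\<^sup>L (distr M borel (std_resid s A) \<Otimes>\<^sub>M distr M borel (std_resid s' B)) h"
proof -
  have "indep_var (PiM (Inl ` A) (\<lambda>_. borel)) (\<lambda>\<omega>. restrict (\<lambda>i. case_sum T X i \<omega>) (Inl ` A))
      (PiM (Inl ` B) (\<lambda>_. borel)) (\<lambda>\<omega>. restrict (\<lambda>i. case_sum T X i \<omega>) (Inl ` B))"
    using A B AB by (intro indep_var_restrict[OF indep_TX]) auto
  from indep_var_compose[OF this, where ?N1.0 = borel and ?N2.0 = borel
      and ?Y1.0 = "\<lambda>x. (\<Sum>j\<in>A. of_bool (x (Inl j) \<le> s) - F s) / sqrt (card A)"
      and ?Y2.0 = "\<lambda>x. (\<Sum>j\<in>B. of_bool (x (Inl j) \<le> s') - F s') / sqrt (card B)"]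
  have "indep_var borel (std_resid s A) borel (std_resid s' B)"
    by (simp add: std_resid_def[abs_def] resid_def comp_def of_bool_def)
  then have "distr M borel (std_resid s A) \<Otimes>\<^sub>M distr M borel (std_resid s' B)
      = distr M (borel \<Otimes>\<^sub>M borel) (\<lambda>\<omega>. (std_resid s A \<omega>, std_resid s' B \<omega>))"
    by (simp add: indep_var_distribution_eq)
  moreover have "h \<in> borel_measurable (borel \<Otimes>\<^sub>M borel)"
    by (simp add: borel_prod)
  ultimately show ?thesis
    using A B by (simp add: integral_distr)
qed

text \<open>The event is a function of the \<open>X\<close> block, while for fixed \<open>A\<close>
  and \<open>B\<close> the standardized sums are functions of the \<open>T\<close> block. The two
  samples are independent, so the expectation factorizes.\<close>

lemma integral_conditional_on_sites:
  fixes h :: "real \<times> real \<Rightarrow> real"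
  assumes A: "A \<subseteq> {1..n}" and B: "B \<subseteq> {1..n}"
    and [measurable]: "h \<in> borel_measurable borel" and C: "\<And>x. \<bar>h x\<bar> \<le> C"
  shows "(\<integral>\<omega>. of_bool (sites s \<omega> = A \<and> sites s' \<omega> = B) * h (std_resid s A \<omega>, std_resid s' B \<omega>) \<partial>M)
    = (\<integral>\<omega>. of_bool (sites s \<omega> = A \<and> sites s' \<omega> = B) \<partial>M)
        * (\<integral>\<omega>. h (std_resid s A \<omega>, std_resid s' B \<omega>) \<partial>M)"
proof -
  let ?I = "\<lambda>\<omega>. of_bool (sites s \<omega> = A \<and> sites s' \<omega> = B) :: real"
  let ?h = "\<lambda>\<omega>. h (std_resid s A \<omega>, std_resid s' B \<omega>)"
  note [measurable] = pred_sites[OF A] pred_sites[OF B] std_resid_rv[OF A] std_resid_rv[OF B]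
  have hb[measurable]: "h \<in> borel_measurable (borel \<Otimes>\<^sub>M borel)"
    by (simp add: borel_prod)
  have meas_sum: "(\<lambda>x. \<Sum>j\<in>J. (if x (Inl j) \<le> r then 1 else 0) - F r)
    \<in> borel_measurable (PiM (Inl ` {1..n} :: (nat + nat) set) (\<lambda>_. borel))" if "J \<subseteq> {1..n}" for J r
  proof (rule borel_measurable_sum)
    fix j assume "j \<in> J"
    then have [measurable]: "(\<lambda>x. x (Inl j)) \<in> borel_measurable (PiM (Inl ` {1..n} :: (nat + nat) set) (\<lambda>_. borel))"
      using that by (intro measurable_component_singleton) auto
    show "(\<lambda>x. (if x (Inl j) \<le> r then 1 else 0) - F r)
        \<in> borel_measurable (PiM (Inl ` {1..n} :: (nat + nat) set) (\<lambda>_. borel))"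
      by measurable
  qed
  have meas_T: "(\<lambda>x. h ((\<Sum>j\<in>A. (if x (Inl j) \<le> s then 1 else 0) - F s) / sqrt (card A),
            (\<Sum>j\<in>B. (if x (Inl j) \<le> s' then 1 else 0) - F s') / sqrt (card B)))
    \<in> borel_measurable (PiM (Inl ` {1..n} :: (nat + nat) set) (\<lambda>_. borel))"
    by (rule measurable_compose[OF _ hb])
      (intro measurable_Pair borel_measurable_divide borel_measurable_const meas_sum A B)
  have "indep_var (PiM (Inr ` {1..n}) (\<lambda>_. borel)) (\<lambda>\<omega>. restrict (\<lambda>i. case_sum T X i \<omega>) (Inr ` {1..n}))
      (PiM (Inl ` {1..n}) (\<lambda>_. borel)) (\<lambda>\<omega>. restrict (\<lambda>i. case_sum T X i \<omega>) (Inl ` {1..n}))"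
    by (intro indep_var_restrict[OF indep_TX]) auto
  from indep_var_compose[OF this _ meas_T, where ?N1.0 = borel
      and ?Y1.0 = "\<lambda>x. if (\<forall>j\<in>{1..n}. x (Inr j) = s \<longleftrightarrow> j \<in> A) \<and> (\<forall>j\<in>{1..n}. x (Inr j) = s' \<longleftrightarrow> j \<in> B)
            then 1 else 0 :: real"]
  \<comment> \<open>Restriction to the \<open>T\<close> block returns \<open>undefined\<close>
    outside \<open>{1..n}\<close>. Since \<open>A\<close> and \<open>B\<close> lie inside, this
    default is never reached, and it is removed below.\<close>
  have 1: "indep_var borel
      (\<lambda>\<omega>. if (\<forall>j\<in>{1..n}. X j \<omega> = s \<longleftrightarrow> j \<in> A) \<and> (\<forall>j\<in>{1..n}. X j \<omega> = s' \<longleftrightarrow> j \<in> B) then 1 else 0 :: real)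
      borel (\<lambda>\<omega>. h ((\<Sum>j\<in>A. (if (if j \<in> {1..n} then T j \<omega> else undefined) \<le> s then 1 else 0) - F s) / sqrt (card A),
            (\<Sum>j\<in>B. (if (if j \<in> {1..n} then T j \<omega> else undefined) \<le> s' then 1 else 0) - F s') / sqrt (card B)))"
    by (simp add: comp_def inj_image_mem_iff cong: if_cong)
  have "indep_var borel ?I borel ?h"
  proof (rule iffD1[OF _ 1, OF arg_cong2[where f = "\<lambda>a b. indep_var borel a borel b"]])
    show "(\<lambda>\<omega>. if (\<forall>j\<in>{1..n}. X j \<omega> = s \<longleftrightarrow> j \<in> A) \<and> (\<forall>j\<in>{1..n}. X j \<omega> = s' \<longleftrightarrow> j \<in> B) then 1 else 0) = ?I"
      using A B by (intro ext) (auto simp: sites_def)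
    have "(\<Sum>j\<in>J. (if (if j \<in> {1..n} then T j \<omega> else undefined) \<le> s then 1 else 0) - F s) = (\<Sum>j\<in>J. resid s j \<omega>)"
      if "J \<subseteq> {1..n}" for J \<omega> s
      using that by (intro sum.cong) (auto simp: resid_def)
    then show "(\<lambda>\<omega>. h ((\<Sum>j\<in>A. (if (if j \<in> {1..n} then T j \<omega> else undefined) \<le> s then 1 else 0) - F s) / sqrt (card A),
            (\<Sum>j\<in>B. (if (if j \<in> {1..n} then T j \<omega> else undefined) \<le> s' then 1 else 0) - F s') / sqrt (card B))) = ?h"
      using A B by (simp add: std_resid_def)
  qed
  moreover have "integrable M ?I"
    by (rule integrable_const_bound[where B = 1]) (auto simp: of_bool_def)
  moreover have "integrable M ?h"
    using C by (intro integrable_const_bound[where B = C]) auto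
  ultimately show ?thesis by (rule indep_var_lebesgue_integral)
qed

text \<open>Total expectation over the finitely many pairs of index sets. Because \<open>s\<close>
  and \<open>s'\<close> differ, the realized sets are disjoint, so \<open>close\<close> applies when
  both are large; otherwise the trivial bound \<open>2 * C\<close> is paid with the probability of a
  small set.\<close>

lemma integral_random_sites:
  fixes h :: "real \<times> real \<Rightarrow> real"
  assumes ss: "s \<noteq> s'" and hm[measurable]: "h \<in> borel_measurable borel" and C: "\<And>x. \<bar>h x\<bar> \<le> C" and L: "\<bar>L\<bar> \<le> C"
    and close: "\<And>A B. A \<subseteq> {1..n} \<Longrightarrow> B \<subseteq> {1..n} \<Longrightarrow> A \<inter> B = {} \<Longrightarrow> k < card A \<Longrightarrow> k < card B \<Longrightarrow>
       \<bar>(\<integral>\<omega>. h (std_resid s A \<omega>, std_resid s' B \<omega>) \<partial>M) - L\<bar> \<le> \<epsilon>"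
    and \<epsilon>: "0 \<le> \<epsilon>"
  shows "\<bar>(\<integral>\<omega>. h (std_resid s (sites s \<omega>) \<omega>, std_resid s' (sites s' \<omega>) \<omega>) \<partial>M) - L\<bar>
     \<le> \<epsilon> + 2 * C * (prob {\<omega> \<in> space M. card (sites s \<omega>) \<le> k} + prob {\<omega> \<in> space M. card (sites s' \<omega>) \<le> k})"
proof -
  let ?P = "Pow {1..n} \<times> Pow {1..n}"
  define I where "I z \<omega> = (of_bool (sites s \<omega> = fst z \<and> sites s' \<omega> = snd z) :: real)" for z \<omega>
  define hh where "hh z \<omega> = h (std_resid s (fst z) \<omega>, std_resid s' (snd z) \<omega>)" for z \<omega>
  define q where "q z = (\<integral>\<omega>. hh z \<omega> \<partial>M)" for z
  have C0: "0 \<le> C" using C[of undefined] by linarith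
  have fin: "finite ?P" by simp
  have hb[measurable]: "h \<in> borel_measurable (borel \<Otimes>\<^sub>M borel)"
    by (simp add: borel_prod)
  have I_meas[measurable]: "I z \<in> borel_measurable M" if "z \<in> ?P" for z
    using that pred_sites[of "fst z" s] pred_sites[of "snd z" s'] unfolding I_def of_bool_def
    by (auto intro!: measurable_If pred_intros_logic)
  have hh_meas[measurable]: "hh z \<in> borel_measurable M" if "z \<in> ?P" for z
    using that std_resid_rv[of "fst z" s] std_resid_rv[of "snd z" s'] unfolding hh_def
    by (auto intro!: measurable_compose[OF _ hb])
  have I_int: "integrable M (I z)" if "z \<in> ?P" for z
    using I_meas[OF that] by (intro integrable_const_bound[where B = 1]) (auto simp: I_def)
  have hh_le: "\<bar>hh z \<omega>\<bar> \<le> C" for z \<omega>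
    using C by (simp add: hh_def)
  have hh_int: "integrable M (hh z)" if "z \<in> ?P" for z
    using hh_meas[OF that] hh_le by (intro integrable_const_bound[where B = C]) auto
  have Ihh_int: "integrable M (\<lambda>\<omega>. I z \<omega> * hh z \<omega>)" if "z \<in> ?P" for z
  proof (rule integrable_const_bound[where B = C])
    show "AE \<omega> in M. norm (I z \<omega> * hh z \<omega>) \<le> C"
      using C C0 by (simp add: I_def hh_def)
  qed (use I_meas[OF that] hh_meas[OF that] in simp)
  \<comment> \<open>Exactly one pair of sets is realized at each outcome. The identity expands a
    function of the random pair into a finite sum, where conditioning works term by term, and
    collapses the sum again afterwards.\<close>
  have pick: "(\<Sum>z\<in>?P. I z \<omega> * \<phi> z) = \<phi> (sites s \<omega>, sites s' \<omega>)" for \<omega> and \<phi> :: "nat set \<times> nat set \<Rightarrow> real"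
  proof -
    have "(\<Sum>z\<in>?P. I z \<omega> * \<phi> z) = (\<Sum>z\<in>?P. if z = (sites s \<omega>, sites s' \<omega>) then \<phi> z else 0)"
      by (intro sum.cong) (auto simp: I_def)
    moreover have "(sites s \<omega>, sites s' \<omega>) \<in> ?P" by (auto simp: sites_def)
    ultimately show ?thesis using fin by (simp only: sum.delta if_True)
  qed
  have "(\<integral>\<omega>. h (std_resid s (sites s \<omega>) \<omega>, std_resid s' (sites s' \<omega>) \<omega>) \<partial>M)
      = (\<integral>\<omega>. (\<Sum>z\<in>?P. I z \<omega> * hh z \<omega>) \<partial>M)"
    by (simp only: pick) (simp add: hh_def)
  also have "\<dots> = (\<Sum>z\<in>?P. (\<integral>\<omega>. I z \<omega> * hh z \<omega> \<partial>M))"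
    by (rule Bochner_Integration.integral_sum[OF Ihh_int])
  also have "\<dots> = (\<Sum>z\<in>?P. (\<integral>\<omega>. I z \<omega> \<partial>M) * q z)"
  proof (rule sum.cong[OF refl])
    fix z assume "z \<in> ?P"
    then have "fst z \<subseteq> {1..n}" "snd z \<subseteq> {1..n}" by auto
    from integral_conditional_on_sites[OF this hm C]
    show "(\<integral>\<omega>. I z \<omega> * hh z \<omega> \<partial>M) = (\<integral>\<omega>. I z \<omega> \<partial>M) * q z"
      unfolding I_def hh_def q_def .
  qed
  also have "\<dots> = (\<integral>\<omega>. (\<Sum>z\<in>?P. I z \<omega> * q z) \<partial>M)"
    using I_int by (subst Bochner_Integration.integral_sum) auto
  also have "\<dots> = (\<integral>\<omega>. q (sites s \<omega>, sites s' \<omega>) \<partial>M)"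
    by (simp only: pick)
  finally have eq: "(\<integral>\<omega>. h (std_resid s (sites s \<omega>) \<omega>, std_resid s' (sites s' \<omega>) \<omega>) \<partial>M)
      = (\<integral>\<omega>. q (sites s \<omega>, sites s' \<omega>) \<partial>M)" .
  have q_int: "integrable M (\<lambda>\<omega>. q (sites s \<omega>, sites s' \<omega>))"
  proof -
    have "integrable M (\<lambda>\<omega>. \<Sum>z\<in>?P. I z \<omega> * q z)"
      using I_int by (intro Bochner_Integration.integrable_sum integrable_mult_left) auto
    then show ?thesis by (simp only: pick)
  qed
  define D where "D s \<omega> = (indicator {\<omega> \<in> space M. card (sites s \<omega>) \<le> k} \<omega> :: real)" for s \<omega>
  have bad_events: "{\<omega> \<in> space M. card (sites s \<omega>) \<le> k} \<in> events" for s
    by measurable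
  have D_int: "integrable M (D s)" for s
    unfolding D_def using bad_events by (intro integrable_real_indicator) (auto simp: emeasure_eq_measure)
  have D_prob: "integral\<^sup>L M (D s) = prob {\<omega> \<in> space M. card (sites s \<omega>) \<le> k}" for s
    unfolding D_def by (simp add: Int_absorb2)
  have "\<bar>q (sites s \<omega>, sites s' \<omega>) - L\<bar> \<le> \<epsilon> + 2 * C * (D s \<omega> + D s' \<omega>)" if "\<omega> \<in> space M" for \<omega>
  proof (cases "k < card (sites s \<omega>) \<and> k < card (sites s' \<omega>)")
    case True
    then have "\<bar>q (sites s \<omega>, sites s' \<omega>) - L\<bar> \<le> \<epsilon>"
      unfolding q_def hh_def fst_conv snd_conv using ss by (intro close) (auto simp: sites_def)
    also have "\<dots> \<le> \<epsilon> + 2 * C * (D s \<omega> + D s' \<omega>)"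
      using C0 by (simp add: D_def)
    finally show ?thesis .
  next
    case False
    then have D1: "1 \<le> D s \<omega> + D s' \<omega>" using that by (auto simp: D_def)
    have z: "(sites s \<omega>, sites s' \<omega>) \<in> ?P" by (auto simp: sites_def)
    have "\<bar>q (sites s \<omega>, sites s' \<omega>)\<bar> \<le> C"
    proof -
      have "\<bar>q (sites s \<omega>, sites s' \<omega>)\<bar> \<le> (\<integral>\<omega>'. \<bar>hh (sites s \<omega>, sites s' \<omega>) \<omega>'\<bar> \<partial>M)"
        unfolding q_def by (rule integral_abs_bound)
      also have "\<dots> \<le> (\<integral>\<omega>'. C \<partial>M)"
        using hh_int[OF z] hh_le by (intro integral_mono integrable_abs) auto
      finally show ?thesis by (simp add: prob_space)
    qed
    then have "\<bar>q (sites s \<omega>, sites s' \<omega>) - L\<bar> \<le> 2 * C * 1" using L by linarith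
    also have "\<dots> \<le> 2 * C * (D s \<omega> + D s' \<omega>)"
      using C0 D1 by (intro mult_left_mono) auto
    finally show ?thesis using \<epsilon> by linarith
  qed
  then have "(\<integral>\<omega>. \<bar>q (sites s \<omega>, sites s' \<omega>) - L\<bar> \<partial>M) \<le> (\<integral>\<omega>. \<epsilon> + 2 * C * (D s \<omega> + D s' \<omega>) \<partial>M)"
    using q_int D_int by (intro integral_mono) auto
  also have "\<dots> = \<epsilon> + 2 * C * (integral\<^sup>L M (D s) + integral\<^sup>L M (D s'))"
    using D_int by (simp add: prob_space)
  finally have "(\<integral>\<omega>. \<bar>q (sites s \<omega>, sites s' \<omega>) - L\<bar> \<partial>M)
      \<le> \<epsilon> + 2 * C * (prob {\<omega> \<in> space M. card (sites s \<omega>) \<le> k} + prob {\<omega> \<in> space M. card (sites s' \<omega>) \<le> k})"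
    unfolding D_prob .
  moreover have "\<bar>(\<integral>\<omega>. q (sites s \<omega>, sites s' \<omega>) \<partial>M) - L\<bar> \<le> (\<integral>\<omega>. \<bar>q (sites s \<omega>, sites s' \<omega>) - L\<bar> \<partial>M)"
  proof -
    have "(\<integral>\<omega>. q (sites s \<omega>, sites s' \<omega>) \<partial>M) - L = (\<integral>\<omega>. q (sites s \<omega>, sites s' \<omega>) - L \<partial>M)"
      using q_int by (simp add: prob_space)
    then show ?thesis by (simp only: integral_abs_bound)
  qed
  ultimately show ?thesis unfolding eq by linarith
qed

end

section \<open>The NPMLE and the naive estimator\<close>

lemma grid_index_eq:
  assumes "strict_mono_on {1..K} t" and i: "i \<in> {1..K}"
  shows "grid_index K t (t i) = i"
  unfolding grid_index_def using assms by (intro Max_eqI) (auto simp: strict_mono_on_leD strict_mono_on_less_eq)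

text \<open>The vector of ratios makes the least squares criterion 0, so it is optimal as soon as it
  is monotone. All weights being positive, the convention for unobserved points is vacuous, and
  uniqueness identifies the chosen vector.\<close>

lemma npmle_eq_ratio:
  assumes t: "strict_mono_on {1..K} t" and i: "i \<in> {1..K}"
    and pos: "\<And>i. i \<in> {1..K} \<Longrightarrow> 0 < obs_count n X (t i)"
    and mono: "mono_on {1..K} (\<lambda>i. real (event_count n T X (t i)) / real (obs_count n X (t i)))"
  shows "npmle K t n T X (t i) = real (event_count n T X (t i)) / real (obs_count n X (t i))"
proof -
  let ?w = "\<lambda>i. real (obs_count n X (t i))"
  let ?z = "\<lambda>i. real (event_count n T X (t i)) / ?w i"
  have z: "is_npmle_vector K ?w ?z ?z"
    using mono pos by (fastforce simp: is_npmle_vector_def isotonic_regression_def intro!: sum_nonneg)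
  define v where "v = (SOME v. is_npmle_vector K ?w ?z v)"
  have "is_npmle_vector K ?w ?z v"
    unfolding v_def by (rule someI[where P = "is_npmle_vector K ?w ?z", OF z])
  then have "v i = ?z i"
    by (intro is_npmle_vector_unique[of K ?w ?z] z i) auto
  moreover have "\<not> t i < t 1"
    using t i by (auto simp: not_less intro!: strict_mono_on_leD[of "{1..K}" t])
  ultimately show ?thesis
    by (simp add: npmle_def v_def[symmetric] grid_index_eq[OF t i] Let_def)
qed

lemma is_npmle_vector_cong:
  assumes "\<And>i. i \<in> {1..K} \<Longrightarrow> w i = w' i" "\<And>i. i \<in> {1..K} \<Longrightarrow> z i = z' i"
  shows "is_npmle_vector K w z v = is_npmle_vector K w' z' v"
proof -
  have "(\<Sum>i=1..K. w i * (z i - u i)\<^sup>2) = (\<Sum>i=1..K. w' i * (z' i - u i)\<^sup>2)" for u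
    using assms by (intro sum.cong) auto
  moreover have "(\<forall>i\<in>{1..K}. w i = 0 \<longrightarrow> Q i) = (\<forall>i\<in>{1..K}. w' i = 0 \<longrightarrow> Q i)" for Q
    using assms(1) by auto
  ultimately show ?thesis
    unfolding is_npmle_vector_def isotonic_regression_def by (simp only:)
qed

text \<open>Prepares measurability. The two predicates under the choice operator are equal for every
  vector, as they inspect weights and ratios on \<open>{1..K}\<close> only, so the choices coincide.
  Lists are indexed from 0, grid points from 1.\<close>

lemma npmle_eq_function_of_counts:
  "npmle K t n T X x =
     (\<lambda>xs. let v = (SOME v. is_npmle_vector K (\<lambda>i. real (fst (xs ! (i - 1))))
                 (\<lambda>i. real (snd (xs ! (i - 1))) / real (fst (xs ! (i - 1)))) v)
      in if x < t 1 then 0 else v (grid_index K t x))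
     (map (\<lambda>i. (obs_count n X (t i), event_count n T X (t i))) [1..<Suc K])"
proof -
  let ?xs = "map (\<lambda>i. (obs_count n X (t i), event_count n T X (t i))) [1..<Suc K]"
  have "?xs ! (i - 1) = (obs_count n X (t i), event_count n T X (t i))" if "i \<in> {1..K}" for i
    using that by (cases i) (simp_all del: upt_Suc)
  then have "is_npmle_vector K (\<lambda>i. real (fst (?xs ! (i - 1))))
        (\<lambda>i. real (snd (?xs ! (i - 1))) / real (fst (?xs ! (i - 1)))) v
      = is_npmle_vector K (\<lambda>i. real (obs_count n X (t i)))
        (\<lambda>i. real (event_count n T X (t i)) / real (obs_count n X (t i))) v" for v
    by (intro is_npmle_vector_cong) (simp_all only: fst_conv snd_conv)
  then show ?thesis by (simp add: npmle_def Let_def)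
qed

lemma sqrt_times_ratio:
  fixes x :: real
  assumes "0 < x"
  shows "sqrt x * (e / x - m) = (e - x * m) / sqrt x"
proof -
  define y where "y = sqrt x"
  have "0 < y" "x = y * y" using assms by (simp_all add: y_def)
  then show ?thesis by (simp add: field_simps real_sqrt_mult)
qed

context current_status
begin

section \<open>The two estimators on the sample space\<close>

lemma obs_count_eq: "obs_count n (\<lambda>j. X j \<omega>) s = card (sites s \<omega>)"
  by (simp add: obs_count_def sites_def)

lemma sum_resid_eq:
  "(\<Sum>j\<in>sites s \<omega>. resid s j \<omega>)
     = real (event_count n (\<lambda>j. T j \<omega>) (\<lambda>j. X j \<omega>) s) - real (card (sites s \<omega>)) * F s"
proof -
  have "{j \<in> {1..n}. X j \<omega> = s \<and> T j \<omega> \<le> X j \<omega>} = sites s \<omega> \<inter> {j. T j \<omega> \<le> s}"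
    by (auto simp: sites_def)
  then show ?thesis
    by (simp add: event_count_def resid_def sum_subtractf sum.If_cases of_bool_def)
qed

lemma std_resid_sites_eq:
  "std_resid s (sites s \<omega>) \<omega> = sqrt (obs_count n (\<lambda>j. X j \<omega>) s)
     * (real (event_count n (\<lambda>j. T j \<omega>) (\<lambda>j. X j \<omega>) s) / real (obs_count n (\<lambda>j. X j \<omega>) s) - F s)"
proof (cases "card (sites s \<omega>) = 0")
  case False
  then show ?thesis
    by (subst sqrt_times_ratio) (simp_all add: std_resid_def sum_resid_eq obs_count_eq card_gt_0_iff)
qed (simp add: std_resid_def obs_count_eq)

lemma std_resid_sites_measurable[measurable]:
  "(\<lambda>\<omega>. std_resid s (sites s \<omega>) \<omega>) \<in> borel_measurable M"
  unfolding std_resid_def by measurable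

text \<open>The choice operator in the definition of \<open>npmle\<close> is no obstacle to measurability, since the
  choice depends on the sample only through a list of counts, which ranges over a countable type.\<close>

lemma npmle_measurable[measurable]:
  "(\<lambda>\<omega>. npmle K t n (\<lambda>j. T j \<omega>) (\<lambda>j. X j \<omega>) x) \<in> borel_measurable M"
proof -
  let ?o = "\<lambda>s \<omega>. obs_count n (\<lambda>j. X j \<omega>) s"
  let ?e = "\<lambda>s \<omega>. event_count n (\<lambda>j. T j \<omega>) (\<lambda>j. X j \<omega>) s"
  have [measurable]: "?o s \<in> M \<rightarrow>\<^sub>M count_space UNIV" for s
    unfolding obs_count_eq by measurable
  \<comment> \<open>Adding back the mean recovers the event count from the residual sum, whose
    measurability is known.\<close>
  have "(\<lambda>\<omega>. (\<Sum>j\<in>sites s \<omega>. resid s j \<omega>) + real (card (sites s \<omega>)) * F s) \<in> borel_measurable M" for s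
    by measurable
  then have [measurable]: "(\<lambda>\<omega>. real (?e s \<omega>)) \<in> borel_measurable M" for s
    by (simp add: sum_resid_eq)
  have [measurable]: "Measurable.pred M (\<lambda>\<omega>. ?e s \<omega> = k)" for s k
  proof -
    have "Measurable.pred M (\<lambda>\<omega>. real (?e s \<omega>) = real k)" by measurable
    then show ?thesis by simp
  qed
  let ?c = "\<lambda>\<omega>. map (\<lambda>i. (?o (t i) \<omega>, ?e (t i) \<omega>)) [1..<Suc K]"
  have "?c \<omega> = xs \<longleftrightarrow> length xs = K \<and>
      (\<forall>k\<in>{..<K}. ?o (t (Suc k)) \<omega> = fst (xs ! k) \<and> ?e (t (Suc k)) \<omega> = snd (xs ! k))" for \<omega> xs
    unfolding list_eq_iff_nth_eq by (auto simp: prod_eq_iff simp del: upt_Suc)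
  moreover have "{\<omega> \<in> space M. length xs = K \<and>
      (\<forall>k\<in>{..<K}. ?o (t (Suc k)) \<omega> = fst (xs ! k) \<and> ?e (t (Suc k)) \<omega> = snd (xs ! k))} \<in> sets M"
    for xs :: "(nat \<times> nat) list"
    by measurable
  ultimately have "{\<omega> \<in> space M. ?c \<omega> = xs} \<in> sets M" for xs
    by simp
  moreover have "?c -` {xs} \<inter> space M = {\<omega> \<in> space M. ?c \<omega> = xs}" for xs
    by auto
  ultimately have "?c \<in> M \<rightarrow>\<^sub>M count_space UNIV"
    by (simp only: measurable_count_space_eq_countable[OF countableI_type]) simp
  then show ?thesis
    by (subst npmle_eq_function_of_counts) (rule measurable_compose, auto)
qed

text \<open>At an empty site both sides of \<open>good\<close> would be 0, so the strict inequality
  already forces every site to be observed. Deviations below \<open>\<theta>\<close> cannot reverse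
  values of \<open>F\<close> that are \<open>2 * \<theta>\<close> apart.\<close>

lemma std_npmle_eq_std_resid:
  assumes t: "strict_mono_on {1..K} t"
    and sep: "\<And>i j. i \<in> {1..K} \<Longrightarrow> j \<in> {1..K} \<Longrightarrow> i < j \<Longrightarrow> 2 * \<theta> \<le> F (t j) - F (t i)"
    and good: "\<And>i. i \<in> {1..K} \<Longrightarrow>
      \<bar>\<Sum>j\<in>sites (t i) \<omega>. resid (t i) j \<omega>\<bar> < \<theta> * card (sites (t i) \<omega>)"
    and i: "i \<in> {1..K}"
  shows "sqrt (obs_count n (\<lambda>j. X j \<omega>) (t i))
       * (npmle K t n (\<lambda>j. T j \<omega>) (\<lambda>j. X j \<omega>) (t i) - F (t i))
     = std_resid (t i) (sites (t i) \<omega>) \<omega>"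
proof -
  let ?o = "\<lambda>i. obs_count n (\<lambda>j. X j \<omega>) (t i)"
  let ?z = "\<lambda>i. real (event_count n (\<lambda>j. T j \<omega>) (\<lambda>j. X j \<omega>) (t i)) / real (?o i)"
  have pos: "0 < ?o i" if "i \<in> {1..K}" for i
    using good[OF that] unfolding obs_count_eq by (cases "card (sites (t i) \<omega>) = 0") auto
  have dev: "\<bar>?z i - F (t i)\<bar> < \<theta>" if i: "i \<in> {1..K}" for i
  proof -
    have "(\<Sum>j\<in>sites (t i) \<omega>. resid (t i) j \<omega>) = (?z i - F (t i)) * ?o i"
      unfolding sum_resid_eq obs_count_eq[symmetric] using pos[OF i] by (simp add: field_simps)
    then have "\<bar>?z i - F (t i)\<bar> * ?o i < \<theta> * ?o i"
      using good[OF i] by (simp add: abs_mult obs_count_eq)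
    then show ?thesis by (rule mult_right_less_imp_less) simp
  qed
  have "mono_on {1..K} ?z"
  proof (rule mono_onI)
    fix i j assume ij: "i \<in> {1..K}" "j \<in> {1..K}" "i \<le> j"
    show "?z i \<le> ?z j"
    proof (cases "i = j")
      case False
      then show ?thesis using dev[OF ij(1)] dev[OF ij(2)] sep[OF ij(1,2)] ij(3) by linarith
    qed simp
  qed
  from npmle_eq_ratio[OF t i pos this] show ?thesis
    by (simp add: std_resid_sites_eq)
qed

text \<open>A union bound over the sites and the two signs, whence the factor
  \<open>2 * real K\<close>.\<close>

lemma prob_site_deviation_le:
  fixes \<theta> p :: real
  assumes \<theta>: "0 \<le> \<theta>" "\<theta> \<le> 1" and p: "\<And>i. i \<in> {1..K} \<Longrightarrow> p \<le> measure H {t i}"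
  shows "prob {\<omega> \<in> space M. \<exists>i\<in>{1..K}. \<theta> * card (sites (t i) \<omega>) \<le> \<bar>\<Sum>j\<in>sites (t i) \<omega>. resid (t i) j \<omega>\<bar>}
    \<le> 2 * real K * exp (- (n * p * \<theta>\<^sup>2 / 8))"
proof -
  define E where "E \<epsilon> i = {\<omega> \<in> space M. \<theta> * card (sites (t i) \<omega>) \<le> \<epsilon> * (\<Sum>j\<in>sites (t i) \<omega>. resid (t i) j \<omega>)}"
    for \<epsilon> :: real and i
  have [measurable]: "E \<epsilon> i \<in> events" for \<epsilon> i unfolding E_def by measurable
  have bound: "prob (E \<epsilon> i) \<le> exp (- (n * p * \<theta>\<^sup>2 / 8))" if "\<bar>\<epsilon>\<bar> = 1" "i \<in> {1..K}" for \<epsilon> i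
  proof -
    have "prob (E \<epsilon> i) \<le> exp (- (n * measure H {t i} * \<theta>\<^sup>2 / 8))"
      unfolding E_def using that \<theta> by (intro prob_site_sum_ge)
    also have "\<dots> \<le> exp (- (n * p * \<theta>\<^sup>2 / 8))"
      using p[OF that(2)] by (auto intro!: divide_right_mono mult_right_mono mult_left_mono)
    finally show ?thesis .
  qed
  have "{\<omega> \<in> space M. \<exists>i\<in>{1..K}. \<theta> * card (sites (t i) \<omega>) \<le> \<bar>\<Sum>j\<in>sites (t i) \<omega>. resid (t i) j \<omega>\<bar>}
      \<subseteq> (\<Union>i\<in>{1..K}. E 1 i \<union> E (- 1) i)"
    by (fastforce simp: E_def abs_if split: if_splits)
  then have "prob {\<omega> \<in> space M. \<exists>i\<in>{1..K}. \<theta> * card (sites (t i) \<omega>) \<le> \<bar>\<Sum>j\<in>sites (t i) \<omega>. resid (t i) j \<omega>\<bar>}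
      \<le> prob (\<Union>i\<in>{1..K}. E 1 i \<union> E (- 1) i)"
    by (rule finite_measure_mono) auto
  also have "\<dots> \<le> (\<Sum>i\<in>{1..K}. prob (E 1 i \<union> E (- 1) i))"
    by (rule finite_measure_subadditive_finite) auto
  also have "\<dots> \<le> (\<Sum>i\<in>{1..K}. 2 * exp (- (n * p * \<theta>\<^sup>2 / 8)))"
  proof (rule sum_mono)
    fix i assume i: "i \<in> {1..K}"
    have "prob (E 1 i \<union> E (- 1) i) \<le> prob (E 1 i) + prob (E (- 1) i)"
      by (rule measure_Un_le) measurable
    also have "\<dots> \<le> 2 * exp (- (n * p * \<theta>\<^sup>2 / 8))"
      using bound[OF _ i, of 1] bound[OF _ i, of "- 1"] by simp
    finally show "prob (E 1 i \<union> E (- 1) i) \<le> 2 * exp (- (n * p * \<theta>\<^sup>2 / 8))" .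
  qed
  finally show ?thesis by simp
qed

text \<open>Three errors add up: \<open>\<epsilon>\<close> for large index sets;
  \<open>2 * C\<close> times the probability of few observations at one of two sites;
  \<open>2 * C\<close> times the probability, at most \<open>2 * real K\<close> exponentials, that
  the estimators may differ.\<close>

lemma integral_std_npmle_close:
  fixes h :: "real \<times> real \<Rightarrow> real" and \<theta> p :: real
  assumes t: "strict_mono_on {1..K} t"
    and sep: "\<And>i j. i \<in> {1..K} \<Longrightarrow> j \<in> {1..K} \<Longrightarrow> i < j \<Longrightarrow> 2 * \<theta> \<le> F (t j) - F (t i)"
    and \<theta>: "0 \<le> \<theta>" "\<theta> \<le> 1"
    and p: "\<And>i. i \<in> {1..K} \<Longrightarrow> p \<le> measure H {t i}"
    and l: "l \<in> {1..K}" and r: "r \<in> {1..K}" and lr: "l \<noteq> r"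
    and h[measurable]: "h \<in> borel_measurable borel" and C: "\<And>x. \<bar>h x\<bar> \<le> C" and L: "\<bar>L\<bar> \<le> C"
    and close: "\<And>A B. A \<subseteq> {1..n} \<Longrightarrow> B \<subseteq> {1..n} \<Longrightarrow> A \<inter> B = {} \<Longrightarrow> k < card A \<Longrightarrow> k < card B \<Longrightarrow>
       \<bar>(\<integral>\<omega>. h (std_resid (t l) A \<omega>, std_resid (t r) B \<omega>) \<partial>M) - L\<bar> \<le> \<epsilon>"
    and \<epsilon>: "0 \<le> \<epsilon>"
  defines "V \<equiv> \<lambda>i \<omega>. sqrt (obs_count n (\<lambda>j. X j \<omega>) (t i))
       * (npmle K t n (\<lambda>j. T j \<omega>) (\<lambda>j. X j \<omega>) (t i) - F (t i))"
  shows "\<bar>integral\<^sup>L (distr M borel (\<lambda>\<omega>. (V l \<omega>, V r \<omega>))) h - L\<bar>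
    \<le> \<epsilon> + 4 * C * exp k * exp (- (n * p / 2)) + 4 * C * real K * exp (- (n * p * \<theta>\<^sup>2 / 8))"
proof -
  have C0: "0 \<le> C" using C[of undefined] by linarith
  define bad where "bad = {\<omega> \<in> space M. \<exists>i\<in>{1..K}.
    \<theta> * card (sites (t i) \<omega>) \<le> \<bar>\<Sum>j\<in>sites (t i) \<omega>. resid (t i) j \<omega>\<bar>}"
  have [measurable]: "bad \<in> events" unfolding bad_def by measurable
  define U where "U i \<omega> = std_resid (t i) (sites (t i) \<omega>) \<omega>" for i \<omega>
  have [measurable]: "U i \<in> borel_measurable M" for i unfolding U_def by measurable
  have [measurable]: "V i \<in> borel_measurable M" for i
    unfolding V_def obs_count_eq by measurable
  have hb[measurable]: "h \<in> borel_measurable (borel \<Otimes>\<^sub>M borel)"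
    by (simp add: borel_prod)
  have pair: "(\<lambda>\<omega>. (V l \<omega>, V r \<omega>)) \<in> borel_measurable M"
    unfolding borel_prod[symmetric] by measurable
  have hU: "integrable M (\<lambda>\<omega>. h (U l \<omega>, U r \<omega>))" and hV: "integrable M (\<lambda>\<omega>. h (V l \<omega>, V r \<omega>))"
    using C by (auto intro!: integrable_const_bound[where B = C])
  have UV: "\<bar>h (V l \<omega>, V r \<omega>) - h (U l \<omega>, U r \<omega>)\<bar> \<le> 2 * C * indicator bad \<omega>" if "\<omega> \<in> space M" for \<omega>
  proof (cases "\<omega> \<in> bad")
    case True
    then show ?thesis using C[of "(V l \<omega>, V r \<omega>)"] C[of "(U l \<omega>, U r \<omega>)"] by simp
  next
    case False
    then have "V i \<omega> = U i \<omega>" if "i \<in> {1..K}" for i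
      unfolding U_def V_def using that \<open>\<omega> \<in> space M\<close>
      by (intro std_npmle_eq_std_resid[OF t sep]) (auto simp: bad_def not_le)
    then show ?thesis using l r False by simp
  qed
  have "\<bar>(\<integral>\<omega>. h (V l \<omega>, V r \<omega>) \<partial>M) - (\<integral>\<omega>. h (U l \<omega>, U r \<omega>) \<partial>M)\<bar>
      \<le> (\<integral>\<omega>. \<bar>h (V l \<omega>, V r \<omega>) - h (U l \<omega>, U r \<omega>)\<bar> \<partial>M)"
    using hU hV by (simp only: integral_abs_bound flip: Bochner_Integration.integral_diff)
  also have "\<dots> \<le> (\<integral>\<omega>. 2 * C * indicator bad \<omega> \<partial>M)"
    using hU hV UV by (intro integral_mono integrable_abs Bochner_Integration.integrable_diff
      integrable_mult_right integrable_real_indicator) (auto simp: emeasure_eq_measure)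
  also have "\<dots> = 2 * C * prob bad" by simp
  also have "\<dots> \<le> 2 * C * (2 * real K * exp (- (n * p * \<theta>\<^sup>2 / 8)))"
    unfolding bad_def using C0 by (intro mult_left_mono prob_site_deviation_le \<theta> p) auto
  finally have 1: "\<bar>(\<integral>\<omega>. h (V l \<omega>, V r \<omega>) \<partial>M) - (\<integral>\<omega>. h (U l \<omega>, U r \<omega>) \<partial>M)\<bar>
      \<le> 4 * C * real K * exp (- (n * p * \<theta>\<^sup>2 / 8))" by simp
  have few: "prob {\<omega> \<in> space M. card (sites (t i) \<omega>) \<le> k} \<le> exp k * exp (- (n * p / 2))"
    if "i \<in> {1..K}" for i
  proof -
    have "prob {\<omega> \<in> space M. card (sites (t i) \<omega>) \<le> k} \<le> exp k * exp (- (n * measure H {t i} / 2))"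
      by (rule prob_card_sites_le)
    also have "\<dots> \<le> exp k * exp (- (n * p / 2))"
      using p[OF that] by (auto intro!: divide_right_mono mult_left_mono)
    finally show ?thesis .
  qed
  have "t l \<noteq> t r" using t l r lr by (metis strict_mono_on_eqD)
  then have "\<bar>(\<integral>\<omega>. h (U l \<omega>, U r \<omega>) \<partial>M) - L\<bar>
     \<le> \<epsilon> + 2 * C * (prob {\<omega> \<in> space M. card (sites (t l) \<omega>) \<le> k}
              + prob {\<omega> \<in> space M. card (sites (t r) \<omega>) \<le> k})"
    unfolding U_def by (intro integral_random_sites h C L close \<epsilon>)
  also have "\<dots> \<le> \<epsilon> + 2 * C * (exp k * exp (- (n * p / 2)) + exp k * exp (- (n * p / 2)))"
    using C0 by (intro add_left_mono mult_left_mono add_mono few l r) auto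
  finally have "\<bar>(\<integral>\<omega>. h (U l \<omega>, U r \<omega>) \<partial>M) - L\<bar> \<le> \<epsilon> + 4 * C * exp k * exp (- (n * p / 2))"
    by (simp add: algebra_simps)
  moreover have "integral\<^sup>L (distr M borel (\<lambda>\<omega>. (V l \<omega>, V r \<omega>))) h = (\<integral>\<omega>. h (V l \<omega>, V r \<omega>) \<partial>M)"
    using pair by (rule integral_distr) measurable
  ultimately show ?thesis using 1 by linarith
qed

end

section \<open>Asymptotics\<close>

lemma grid_point_le:
  assumes "0 < \<delta>" "i \<in> {1..grid_size a b \<delta>}"
  shows "grid_point a \<delta> i \<le> b"
proof -
  have "int i \<le> \<lfloor>(b - a) / \<delta>\<rfloor>"
    using assms(2) unfolding grid_size_def by simp linarith
  then have "real i \<le> (b - a) / \<delta>"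
    by (simp add: le_floor_iff)
  then show ?thesis using assms(1) by (simp add: grid_point_def field_simps)
qed

lemma grid_point_diff: "grid_point a \<delta> j - grid_point a \<delta> i = (real j - real i) * \<delta>"
  by (simp add: grid_point_def algebra_simps)

lemma strict_mono_grid_point: "0 < \<delta> \<Longrightarrow> strict_mono_on A (grid_point a \<delta>)"
  by (auto intro!: strict_mono_onI simp: grid_point_def)

text \<open>The left index may be 0, where the grid point is \<open>a\<close>; the bound for the
  first weight of the design distribution uses this case.\<close>

lemma grid_point_increment_ge:
  assumes F: "has_lebesgue_density F f" and m: "0 \<le> m" "\<forall>x\<in>{a..b}. m \<le> f x"
    and \<delta>: "0 < \<delta>" and j: "j \<in> {1..grid_size a b \<delta>}" and ij: "i < j"
  shows "m * \<delta> \<le> F (grid_point a \<delta> j) - F (grid_point a \<delta> i)"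
proof -
  have d: "\<delta> \<le> grid_point a \<delta> j - grid_point a \<delta> i"
    unfolding grid_point_diff using ij \<delta> by (simp add: mult_le_cancel_right1)
  have "m * \<delta> \<le> m * (grid_point a \<delta> j - grid_point a \<delta> i)"
    using d m by (intro mult_left_mono)
  also have "\<dots> \<le> F (grid_point a \<delta> j) - F (grid_point a \<delta> i)"
  proof (rule cdf_increment_ge[OF F _ m(1)])
    fix z assume "z \<in> {grid_point a \<delta> i..grid_point a \<delta> j}"
    moreover have "a \<le> grid_point a \<delta> i" using \<delta> by (simp add: grid_point_def)
    ultimately have "z \<in> {a..b}" using grid_point_le[OF \<delta> j] by auto
    then show "m \<le> f z" using m by auto
  qed (use d \<delta> in linarith)
  finally show ?thesis .
qed

text \<open>Interior weights are increments of \<open>G\<close> over a cell. The first and the last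
  dominate such increments, because \<open>G\<close> is nonnegative at
  \<open>grid_point a \<delta> 0\<close> and at most 1 at the last grid point.\<close>

lemma measure_grid_law_ge:
  assumes G: "has_lebesgue_density G g" and m: "0 \<le> m" "\<forall>x\<in>{a..b}. m \<le> g x"
    and \<delta>: "0 < \<delta>" and K: "2 \<le> grid_size a b \<delta>" and i: "i \<in> {1..grid_size a b \<delta>}"
  shows "m * \<delta> \<le> measure (grid_law G (grid_size a b \<delta>) (grid_point a \<delta>)) {grid_point a \<delta> i}"
proof -
  let ?K = "grid_size a b \<delta>" and ?t = "grid_point a \<delta>"
  note inc = grid_point_increment_ge[OF G m \<delta>]
  have w: "m * \<delta> \<le> grid_weight G ?K ?t i"
    using inc[OF i, of "i - 1"] i K has_lebesgue_density_bounds[OF G, of "?t 0"]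
      has_lebesgue_density_bounds[OF G, of "?t ?K"]
    by (auto simp: grid_weight_def)
  \<comment> \<open>A negative weight would be truncated by \<open>ennreal\<close>; nonnegativity
    makes the measure equal to the weight.\<close>
  have "0 \<le> m * \<delta>" using m \<delta> by simp
  then have "0 \<le> grid_weight G ?K ?t i" using w by linarith
  then show ?thesis
    using w i \<delta> by (simp add: measure_def emeasure_grid_law strict_mono_on_imp_inj_on strict_mono_grid_point)
qed

text \<open>The condition on \<open>x - a\<close> puts the first grid point at or below
  \<open>x\<close>, so the maximum is over a nonempty set; the condition on \<open>b - x\<close>
  leaves room for one more point. By maximality \<open>x\<close> lies in the cell of length
  \<open>\<delta>\<close> between the two.\<close>

lemma grid_index_bounds:
  assumes \<delta>: "0 < \<delta>" "\<delta> \<le> x - a" "\<delta> \<le> b - x"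
  defines "K \<equiv> grid_size a b \<delta>"
  defines "l \<equiv> grid_index K (grid_point a \<delta>) x"
  shows "l \<in> {1..K}" "l + 1 \<in> {1..K}"
    "\<bar>grid_point a \<delta> l - x\<bar> \<le> \<delta>" "\<bar>grid_point a \<delta> (l + 1) - x\<bar> \<le> \<delta>"
proof -
  let ?S = "{i \<in> {1..K}. grid_point a \<delta> i \<le> x}"
  have K_ge: "i \<le> K" if "real i * \<delta> \<le> b - a" for i
    using that \<delta> by (auto simp: K_def grid_size_def le_nat_iff le_floor_iff field_simps)
  have "1 \<in> ?S" using \<delta> K_ge[of 1] by (auto simp: grid_point_def)
  then have "l \<in> ?S" unfolding l_def grid_index_def by (intro Max_in) auto
  then have l: "l \<in> {1..K}" and lx: "grid_point a \<delta> l \<le> x" by auto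
  have "l + 1 \<le> K"
    using lx \<delta> by (intro K_ge) (auto simp: grid_point_def algebra_simps)
  then have l1: "l + 1 \<in> {1..K}" by simp
  have "x < grid_point a \<delta> (l + 1)"
  proof (rule ccontr)
    assume "\<not> x < grid_point a \<delta> (l + 1)"
    then have "l + 1 \<in> ?S" using l1 by simp
    then have "l + 1 \<le> l" unfolding l_def grid_index_def by (intro Max_ge) auto
    then show False by simp
  qed
  moreover have "grid_point a \<delta> (l + 1) = grid_point a \<delta> l + \<delta>"
    by (simp add: grid_point_def algebra_simps)
  ultimately show "l \<in> {1..K}" "l + 1 \<in> {1..K}"
    "\<bar>grid_point a \<delta> l - x\<bar> \<le> \<delta>" "\<bar>grid_point a \<delta> (l + 1) - x\<bar> \<le> \<delta>"
    using l l1 lx by auto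
qed

text \<open>The size \<open>k\<close> has to work for all pairs of sets at once. If none did, each
  \<open>k\<close> would yield a late row and two disjoint sets larger than \<open>k\<close> with
  error above \<open>\<epsilon>\<close>; along these the array limit theorem and the product lemma
  force the error to 0.\<close>

lemma std_resid_pair_uniform_limit:
  fixes h :: "real \<times> real \<Rightarrow> real"
  assumes cs: "\<And>n. n0 \<le> n \<Longrightarrow> current_status (M n) n F f (H n) (T n) (X n)"
    and s: "(\<lambda>n. F (s n)) \<longlonglongrightarrow> p" and s': "(\<lambda>n. F (s' n)) \<longlonglongrightarrow> p"
    and p: "0 \<le> p" "p \<le> 1"
    and h: "continuous_on UNIV h" "bounded (range h)" and \<epsilon>: "0 < \<epsilon>"
  defines "\<mu> \<equiv> distr std_normal_distribution borel (\<lambda>x. sqrt (p * (1 - p)) * x)"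
  shows "\<exists>k n1. \<forall>n\<ge>n1. \<forall>A B. A \<subseteq> {1..n} \<longrightarrow> B \<subseteq> {1..n} \<longrightarrow> A \<inter> B = {} \<longrightarrow>
     k < card A \<longrightarrow> k < card B \<longrightarrow>
     \<bar>(\<integral>\<omega>. h (current_status.std_resid F (T n) (s n) A \<omega>, current_status.std_resid F (T n) (s' n) B \<omega>) \<partial>M n)
        - integral\<^sup>L (\<mu> \<Otimes>\<^sub>M \<mu>) h\<bar> \<le> \<epsilon>"
proof (rule ccontr)
  let ?U = "\<lambda>s n. current_status.std_resid F (T n) (s n)"
  let ?q = "\<lambda>n A B. \<integral>\<omega>. h (?U s n A \<omega>, ?U s' n B \<omega>) \<partial>M n"
  let ?L = "integral\<^sup>L (\<mu> \<Otimes>\<^sub>M \<mu>) h"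
  assume "\<not> ?thesis"
  then have ex: "\<exists>n A B. m \<le> n \<and> A \<subseteq> {1..n} \<and> B \<subseteq> {1..n} \<and> A \<inter> B = {} \<and>
      k < card A \<and> k < card B \<and> \<epsilon> < \<bar>?q n A B - ?L\<bar>" for k m
    by (simp add: not_le)
  \<comment> \<open>The bound \<open>max k n0\<close> places the chosen rows where the model is
    available and sends them to infinity, so limits along n pass to limits along
    \<open>N k\<close>.\<close>
  define P where "P k n A B \<longleftrightarrow> max k n0 \<le> n \<and> A \<subseteq> {1..n} \<and> B \<subseteq> {1..n} \<and> A \<inter> B = {} \<and>
      k < card A \<and> k < card B \<and> \<epsilon> < \<bar>?q n A B - ?L\<bar>" for k n A B
  have "\<forall>k. \<exists>n A B. P k n A B"
    unfolding P_def by (intro allI ex)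
  then obtain N A B where P: "\<And>k. P k (N k) (A k) (B k)"
    by metis
  then have NAB: "\<And>k. max k n0 \<le> N k" "\<And>k. A k \<subseteq> {1..N k}" "\<And>k. B k \<subseteq> {1..N k}"
      "\<And>k. A k \<inter> B k = {}" "\<And>k. k < card (A k)" "\<And>k. k < card (B k)"
      and far: "\<And>k. \<epsilon> < \<bar>?q (N k) (A k) (B k) - ?L\<bar>"
    unfolding P_def by blast+
  have cs': "current_status (M (N k)) (N k) F f (H (N k)) (T (N k)) (X (N k))" for k
    using NAB(1)[of k] by (intro cs) simp
  have N_lim: "filterlim N at_top sequentially"
    using NAB(1) by (intro filterlim_at_top_mono[OF filterlim_ident]) auto
  have hm: "h \<in> borel_measurable borel"
    by (rule borel_measurable_continuous_onI[OF h(1)])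
  have real_distr: "real_distribution (distr (M (N k)) borel (?U r (N k) J))"
    if "J \<subseteq> {1..N k}" for r k J
  proof -
    interpret current_status "M (N k)" "N k" F f "H (N k)" "T (N k)" "X (N k)" by (rule cs')
    show ?thesis using std_resid_rv[OF that] by (rule real_distribution_distr)
  qed
  have clt: "weak_conv_m (\<lambda>k. distr (M (N k)) borel (?U r (N k) (J k))) \<mu>"
    if r: "(\<lambda>n. F (r n)) \<longlonglongrightarrow> p" and J: "\<And>k. J k \<subseteq> {1..N k}" "\<And>k. k < card (J k)" for r J
  proof -
    have var: "(\<lambda>k. F (r (N k)) * (1 - F (r (N k)))) \<longlonglongrightarrow> (sqrt (p * (1 - p)))\<^sup>2"
      using p filterlim_compose[OF r N_lim] by (auto intro!: tendsto_intros)
    have "filterlim (\<lambda>k. card (J k)) at_top sequentially"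
      using J(2) by (intro filterlim_at_top_mono[OF filterlim_ident] always_eventually allI less_imp_le)
    then have "weak_conv_m (\<lambda>k. distr (M (N k)) borel
        (\<lambda>\<omega>. (\<Sum>j\<in>J k. current_status.resid F (T (N k)) (r (N k)) j \<omega>) / sqrt (card (J k)))) \<mu>"
      unfolding \<mu>_def
    proof (rule clt_bounded_array[OF _ _ _ _ _ var, rotated -1])
      fix k
      interpret current_status "M (N k)" "N k" F f "H (N k)" "T (N k)" "X (N k)" by (rule cs')
      show "prob_space (M (N k))" by (rule prob_space_axioms)
      show "indep_vars (\<lambda>_. borel) (resid (r (N k))) (J k)" by (rule indep_resid[OF J(1)])
      fix j assume j: "j \<in> J k"
      then have j': "j \<in> {1..N k}" using J(1) by blast
      show "\<bar>resid (r (N k)) j \<omega>\<bar> \<le> 1" for \<omega> by (rule abs_resid_le)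
      show "expectation (resid (r (N k)) j) = 0" by (rule integral_resid[OF j'])
      show "expectation (\<lambda>\<omega>. (resid (r (N k)) j \<omega>)\<^sup>2) = F (r (N k)) * (1 - F (r (N k)))"
        by (rule integral_resid_square[OF j'])
    qed
    then show ?thesis
      by (simp add: current_status.std_resid_def[OF cs', abs_def])
  qed
  have "(\<lambda>k. integral\<^sup>L (distr (M (N k)) borel (?U s (N k) (A k)) \<Otimes>\<^sub>M
      distr (M (N k)) borel (?U s' (N k) (B k))) h) \<longlonglongrightarrow> ?L"
    by (intro weak_conv_m_pair real_distr clt s s' NAB h)
      (auto simp: \<mu>_def intro: real_distribution_scaled_normal)
  then have "(\<lambda>k. ?q (N k) (A k) (B k)) \<longlonglongrightarrow> ?L"
    by (simp add: current_status.integral_std_resid_pair[OF cs' NAB(2) NAB(3) NAB(4) hm])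
  then have "\<forall>\<^sub>F k in sequentially. dist (?q (N k) (A k) (B k)) ?L < \<epsilon>"
    using \<epsilon> by (rule tendstoD)
  then obtain k where "dist (?q (N k) (A k) (B k)) ?L < \<epsilon>"
    by (meson eventually_happens sequentially_bot)
  with far[of k] show False by (simp add: dist_real_def)
qed

text \<open>Scalar multiplication in the plane acts coordinatewise, so the scaled product law is the
  product of the scaled laws.\<close>

lemma integral_scaled_normal_pair:
  fixes h :: "real \<times> real \<Rightarrow> real"
  assumes [measurable]: "h \<in> borel_measurable borel"
  shows "integral\<^sup>L (distr (std_normal_distribution \<Otimes>\<^sub>M std_normal_distribution) borel (\<lambda>z. \<sigma> *\<^sub>R z)) h
    = integral\<^sup>L (distr std_normal_distribution borel (\<lambda>x. \<sigma> * x)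
        \<Otimes>\<^sub>M distr std_normal_distribution borel (\<lambda>x. \<sigma> * x)) h"
proof -
  interpret D: real_distribution "distr std_normal_distribution borel (\<lambda>x. \<sigma> * x)"
    by (rule real_distribution_scaled_normal)
  let ?N = "std_normal_distribution \<Otimes>\<^sub>M std_normal_distribution"
  have "distr std_normal_distribution borel (\<lambda>x. \<sigma> * x)
        \<Otimes>\<^sub>M distr std_normal_distribution borel (\<lambda>x. \<sigma> * x)
      = distr ?N (borel \<Otimes>\<^sub>M borel) (\<lambda>(x, y). (\<sigma> * x, \<sigma> * y))"
    by (rule pair_measure_distr) (auto intro: D.sigma_finite_measure_axioms)
  also have "\<dots> = distr ?N borel (\<lambda>z. \<sigma> *\<^sub>R z)"
    unfolding borel_prod by (intro distr_cong) auto
  finally show ?thesis by simp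
qed

text \<open>The exponents grow like n to the powers \<open>1 - \<gamma>\<close> and
  \<open>1 - 3 * \<gamma>\<close>; the second beats the polynomial factor
  \<open>D / spacing c \<gamma> n\<close>, of order n to the power \<open>\<gamma>\<close>.\<close>

lemma spacing_asymptotics:
  fixes c \<gamma> C g_l f_l k D :: real
  assumes "0 < c" "0 < \<gamma>" "\<gamma> < 1/3" "0 < g_l" "0 < f_l"
  shows "spacing c \<gamma> \<longlonglongrightarrow> 0"
    and "(\<lambda>n. 4 * C * exp k * exp (- (real n * (g_l * spacing c \<gamma> n) / 2))
        + 4 * C * (D / spacing c \<gamma> n)
            * exp (- (real n * (g_l * spacing c \<gamma> n) * (f_l * spacing c \<gamma> n / 2)\<^sup>2 / 8))) \<longlonglongrightarrow> 0"
proof -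
  show "spacing c \<gamma> \<longlonglongrightarrow> 0"
    unfolding spacing_def[abs_def] using assms by real_asymp
  show "(\<lambda>n. 4 * C * exp k * exp (- (real n * (g_l * spacing c \<gamma> n) / 2))
        + 4 * C * (D / spacing c \<gamma> n)
            * exp (- (real n * (g_l * spacing c \<gamma> n) * (f_l * spacing c \<gamma> n / 2)\<^sup>2 / 8))) \<longlonglongrightarrow> 0"
    unfolding spacing_def using assms by real_asymp
qed

theorem theorem3p1:
  fixes F f G g :: "real \<Rightarrow> real" and a' a b x0 c \<gamma> f_l g_l :: real and b' :: ereal
    and M :: "nat \<Rightarrow> 'w measure" and T X :: "nat \<Rightarrow> nat \<Rightarrow> 'w \<Rightarrow> real"
    and \<delta> :: "nat \<Rightarrow> real" and K l :: "nat \<Rightarrow> nat" and t :: "nat \<Rightarrow> nat \<Rightarrow> real"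
    and Fhat :: "nat \<Rightarrow> 'w \<Rightarrow> real \<Rightarrow> real" and N :: "nat \<Rightarrow> 'w \<Rightarrow> nat \<Rightarrow> nat"
  defines "\<delta> \<equiv> \<lambda>n. spacing c \<gamma> n"
    and "K \<equiv> \<lambda>n. grid_size a b (\<delta> n)"
    and "t \<equiv> \<lambda>n. grid_point a (\<delta> n)"
    and "l \<equiv> \<lambda>n. grid_index (K n) (t n) x0"
    and "N \<equiv> \<lambda>n \<omega> i. obs_count n (\<lambda>j. X n j \<omega>) (t n i)"
    and "Fhat \<equiv> \<lambda>n \<omega>. npmle (K n) (t n) n (\<lambda>j. T n j \<omega>) (\<lambda>j. X n j \<omega>)"
  assumes "0 \<le> a'" "a' \<le> a" "a < b" "ereal b < b'"
    and "has_lebesgue_density F f"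
    and "AE x in density lborel (\<lambda>x. ennreal (f x)). a' \<le> x \<and> ereal x \<le> b'"
    and "has_lebesgue_density G g"
    and "\<forall>x\<in>{a..b}. \<forall>\<epsilon>>0. G (x - \<epsilon>) < G (x + \<epsilon>)"
    and "0 < c" "0 < \<gamma>" "\<gamma> < 1/3"
    and sample: "\<And>n. 2 \<le> K n \<Longrightarrow>
           current_status_sample (M n) n f (grid_law G (K n) (t n)) (T n) (X n)"
    and "x0 \<in> {a<..<b}"
    and smooth: "\<exists>U. open U \<and> x0 \<in> U \<and> (\<forall>x\<in>U. F differentiable (at x)) \<and> continuous_on U (deriv F)"
    and A1_1: "bounded (f ` {a..b})" "0 < f_l" "\<forall>x\<in>{a..b}. f_l < f x"
    and A1_2: "bounded (g ` {a..b})" "0 < g_l" "\<forall>x\<in>{a..b}. g_l \<le> g x"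
    and A1_3: "a' < a" "0 < F a"
  shows "weak_conv_measures
    (\<lambda>n. distr (M n) borel (\<lambda>\<omega>.
       (sqrt (N n \<omega> (l n)) * (Fhat n \<omega> (t n (l n)) - F (t n (l n))),
        sqrt (N n \<omega> (l n + 1)) * (Fhat n \<omega> (t n (l n + 1)) - F (t n (l n + 1))))))
    (distr (std_normal_distribution \<Otimes>\<^sub>M std_normal_distribution) borel
       (\<lambda>z. sqrt (F x0 * (1 - F x0)) *\<^sub>R z))"
proof -
  note F_density = \<open>has_lebesgue_density F f\<close> and G_density = \<open>has_lebesgue_density G g\<close>
  have \<delta>_lim: "\<delta> \<longlonglongrightarrow> 0"
    using spacing_asymptotics(1)[of c \<gamma>] \<open>0 < c\<close> \<open>0 < \<gamma>\<close> \<open>\<gamma> < 1/3\<close> A1_1(2) A1_2(2)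
    by (simp add: \<delta>_def)
  \<comment> \<open>The last condition is \<open>\<theta> \<le> 1\<close> from the Chernoff bound,
    the middle two locate \<open>x0\<close> in a cell. Positivity excludes \<open>n = 0\<close>,
    where \<open>powr\<close> makes the spacing 0.\<close>
  have ev: "\<forall>\<^sub>F n in sequentially. 0 < \<delta> n \<and> \<delta> n \<le> x0 - a \<and> \<delta> n \<le> b - x0 \<and> f_l * \<delta> n / 2 \<le> 1"
  proof -
    have small: "\<forall>\<^sub>F n in sequentially. \<delta> n < r" if "0 < r" for r
      using order_tendstoD(2)[OF \<delta>_lim that] .
    have "0 < x0 - a" "0 < b - x0" "0 < 2 / f_l"
      using \<open>x0 \<in> {a<..<b}\<close> A1_1(2) by auto
    from small[OF this(1)] small[OF this(2)] small[OF this(3)] eventually_gt_at_top[of 0]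
    show ?thesis
    proof eventually_elim
      case (elim n)
      then show ?case
        using \<open>0 < c\<close> A1_1(2) by (auto simp: \<delta>_def spacing_def field_simps)
    qed
  qed
  then obtain n0 where n0: "\<And>n. n0 \<le> n \<Longrightarrow> 0 < \<delta> n" "\<And>n. n0 \<le> n \<Longrightarrow> \<delta> n \<le> x0 - a"
      "\<And>n. n0 \<le> n \<Longrightarrow> \<delta> n \<le> b - x0" "\<And>n. n0 \<le> n \<Longrightarrow> f_l * \<delta> n / 2 \<le> 1"
    by (auto simp: eventually_sequentially)
  have l: "l n \<in> {1..K n}" "l n + 1 \<in> {1..K n}"
      "\<bar>t n (l n) - x0\<bar> \<le> \<delta> n" "\<bar>t n (l n + 1) - x0\<bar> \<le> \<delta> n" if "n0 \<le> n" for n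
    using grid_index_bounds[OF n0(1-3)[OF that]] by (simp_all add: l_def K_def t_def)
  \<comment> \<open>Two distinct indices in \<open>{1..K n}\<close> force at least two grid points,
    which makes the sampling assumption available.\<close>
  have K2: "2 \<le> K n" if "n0 \<le> n" for n using l(1,2)[OF that] by simp
  define H where "H n = grid_law G (K n) (t n)" for n
  have cs: "current_status (M n) n F f (H n) (T n) (X n)" if "n0 \<le> n" for n
    using sample[OF K2[OF that]] F_density
    by (simp add: current_status_def current_status_axioms_def H_def current_status_sample_def)
  define \<sigma> where "\<sigma> = sqrt (F x0 * (1 - F x0))"
  define \<mu> where "\<mu> = distr std_normal_distribution borel (\<lambda>x. \<sigma> * x)"
  have cont: "isCont F x0"
    using smooth by (auto intro: differentiable_imp_continuous_within)
  have lim_F: "(\<lambda>n. F (s n)) \<longlonglongrightarrow> F x0" if "\<And>n. n0 \<le> n \<Longrightarrow> \<bar>s n - x0\<bar> \<le> \<delta> n" for s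
  proof (rule isCont_tendsto_compose[OF cont])
    have "(\<lambda>n. s n - x0) \<longlonglongrightarrow> 0"
    proof (rule Lim_null_comparison)
      show "\<delta> \<longlonglongrightarrow> 0" by (rule \<delta>_lim)
      show "\<forall>\<^sub>F n in sequentially. norm (s n - x0) \<le> \<delta> n"
        using that by (auto simp: eventually_sequentially)
    qed
    then show "s \<longlonglongrightarrow> x0" by (simp add: LIM_zero_iff)
  qed
  show ?thesis
    unfolding weak_conv_measures_def
  proof (intro allI impI)
    fix h :: "real \<times> real \<Rightarrow> real"
    assume h: "continuous_on UNIV h" "bounded (range h)"
    have hm: "h \<in> borel_measurable borel"
      by (rule borel_measurable_continuous_onI[OF h(1)])
    obtain C where C: "\<And>x. \<bar>h x\<bar> \<le> C"
      using h(2) unfolding bounded_iff by (metis rangeI real_norm_def)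
    have C0: "0 \<le> C" using C[of undefined] by linarith
    define L where "L = integral\<^sup>L (\<mu> \<Otimes>\<^sub>M \<mu>) h"
    have L_eq: "integral\<^sup>L (distr (std_normal_distribution \<Otimes>\<^sub>M std_normal_distribution) borel
       (\<lambda>z. sqrt (F x0 * (1 - F x0)) *\<^sub>R z)) h = L"
      unfolding L_def \<mu>_def \<sigma>_def by (rule integral_scaled_normal_pair[OF hm])
    have L: "\<bar>L\<bar> \<le> C"
    proof -
      interpret D: real_distribution \<mu> unfolding \<mu>_def by (rule real_distribution_scaled_normal)
      interpret P: pair_prob_space \<mu> \<mu> ..
      have "sets (\<mu> \<Otimes>\<^sub>M \<mu>) = sets (borel :: (real \<times> real) measure)"
        by (simp add: \<mu>_def borel_prod[symmetric] cong: sets_pair_measure_cong)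
      then have hm': "h \<in> borel_measurable (\<mu> \<Otimes>\<^sub>M \<mu>)"
        using hm by (simp cong: measurable_cong_sets)
      have "\<bar>L\<bar> \<le> (\<integral>z. \<bar>h z\<bar> \<partial>(\<mu> \<Otimes>\<^sub>M \<mu>))"
        unfolding L_def by (rule integral_abs_bound)
      also have "\<dots> \<le> (\<integral>z. C \<partial>(\<mu> \<Otimes>\<^sub>M \<mu>))"
        using hm' C C0 by (intro integral_mono integrable_abs P.integrable_const_bound[where B = C]) auto
      finally show ?thesis by (simp add: P.prob_space)
    qed
    let ?V = "\<lambda>n \<omega>. (sqrt (N n \<omega> (l n)) * (Fhat n \<omega> (t n (l n)) - F (t n (l n))),
        sqrt (N n \<omega> (l n + 1)) * (Fhat n \<omega> (t n (l n + 1)) - F (t n (l n + 1))))"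
    have "(\<lambda>n. integral\<^sup>L (distr (M n) borel (?V n)) h) \<longlonglongrightarrow> L"
    proof (rule LIMSEQ_I)
      fix \<epsilon> :: real assume "0 < \<epsilon>"
      then have \<epsilon>: "0 < \<epsilon> / 2" by simp
      have "\<exists>k n1. \<forall>n\<ge>n1. \<forall>A B. A \<subseteq> {1..n} \<longrightarrow> B \<subseteq> {1..n} \<longrightarrow> A \<inter> B = {} \<longrightarrow>
         k < card A \<longrightarrow> k < card B \<longrightarrow>
         \<bar>(\<integral>\<omega>. h (current_status.std_resid F (T n) (t n (l n)) A \<omega>,
                  current_status.std_resid F (T n) (t n (l n + 1)) B \<omega>) \<partial>M n) - L\<bar> \<le> \<epsilon> / 2"
        unfolding L_def \<mu>_def \<sigma>_def
        by (rule std_resid_pair_uniform_limit[OF cs lim_F[OF l(3)] lim_F[OF l(4)]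
            has_lebesgue_density_bounds[OF F_density] h \<epsilon>])
      then obtain k n1 where close: "\<forall>n\<ge>n1. \<forall>A B. A \<subseteq> {1..n} \<longrightarrow> B \<subseteq> {1..n} \<longrightarrow> A \<inter> B = {} \<longrightarrow>
         k < card A \<longrightarrow> k < card B \<longrightarrow>
         \<bar>(\<integral>\<omega>. h (current_status.std_resid F (T n) (t n (l n)) A \<omega>,
                  current_status.std_resid F (T n) (t n (l n + 1)) B \<omega>) \<partial>M n) - L\<bar> \<le> \<epsilon> / 2"
        by (elim exE)
      \<comment> \<open>\<open>K n\<close> is replaced by its bound
        \<open>(b - a) / \<delta> n\<close>, which has a closed form in n. Since \<open>k\<close>
        was fixed before n, the factor \<open>exp (real k)\<close> is a constant.\<close>
      define R where "R n = 4 * C * exp (real k) * exp (- (real n * (g_l * \<delta> n) / 2))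
        + 4 * C * ((b - a) / \<delta> n) * exp (- (real n * (g_l * \<delta> n) * (f_l * \<delta> n / 2)\<^sup>2 / 8))" for n
      have "R \<longlonglongrightarrow> 0"
        unfolding R_def \<delta>_def
        using spacing_asymptotics(2) \<open>0 < c\<close> \<open>0 < \<gamma>\<close> \<open>\<gamma> < 1/3\<close> A1_2(2) A1_1(2) by blast
      then obtain n2 where n2: "\<And>n. n2 \<le> n \<Longrightarrow> R n < \<epsilon> / 2"
        using order_tendstoD(2)[OF _ \<epsilon>] by (metis eventually_sequentially)
      have "norm (integral\<^sup>L (distr (M n) borel (?V n)) h - L) < \<epsilon>" if n: "max n0 (max n1 n2) \<le> n" for n
      proof -
        have n_ge: "n0 \<le> n" "n1 \<le> n" "n2 \<le> n" using n by auto
        interpret current_status "M n" n F f "H n" "T n" "X n" by (rule cs[OF n_ge(1)])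
        have "\<bar>integral\<^sup>L (distr (M n) borel (?V n)) h - L\<bar>
            \<le> \<epsilon> / 2 + 4 * C * exp (real k) * exp (- (real n * (g_l * \<delta> n) / 2))
              + 4 * C * real (K n) * exp (- (real n * (g_l * \<delta> n) * (f_l * \<delta> n / 2)\<^sup>2 / 8))"
          unfolding N_def Fhat_def
        \<comment> \<open>Applied with \<open>\<theta> = f_l * \<delta> n / 2\<close> and
          \<open>p = g_l * \<delta> n\<close>.\<close>
        proof (rule integral_std_npmle_close)
          show "strict_mono_on {1..K n} (t n)"
            unfolding t_def by (rule strict_mono_grid_point[OF n0(1)[OF n_ge(1)]])
          show "2 * (f_l * \<delta> n / 2) \<le> F (t n j) - F (t n i)"
            if "i \<in> {1..K n}" "j \<in> {1..K n}" "i < j" for i j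
            using grid_point_increment_ge[OF F_density, of f_l a b "\<delta> n" j i] that A1_1 n0(1)[OF n_ge(1)]
            by (auto simp: t_def K_def less_imp_le)
          show "0 \<le> f_l * \<delta> n / 2" using A1_1(2) n0(1)[OF n_ge(1)] by simp
          show "g_l * \<delta> n \<le> measure (H n) {t n i}" if "i \<in> {1..K n}" for i
            using measure_grid_law_ge[OF G_density, of g_l a b "\<delta> n" i] that A1_2 n0(1)[OF n_ge(1)] K2[OF n_ge(1)]
            by (simp add: H_def t_def K_def)
          show "\<bar>expectation (\<lambda>\<omega>. h (std_resid (t n (l n)) A \<omega>, std_resid (t n (l n + 1)) B \<omega>)) - L\<bar> \<le> \<epsilon> / 2"
            if "A \<subseteq> {1..n}" "B \<subseteq> {1..n}" "A \<inter> B = {}" "k < card A" "k < card B" for A B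
            using close n_ge(2) that by blast
        qed (use n0(4) l n_ge hm C L \<epsilon> in auto)
        also have "\<dots> \<le> \<epsilon> / 2 + R n"
        proof -
          have "real (K n) \<le> (b - a) / \<delta> n"
            using n0(1)[OF n_ge(1)] \<open>a < b\<close> by (simp add: K_def grid_size_def of_nat_floor)
          then show ?thesis
            unfolding R_def add.assoc using C0 by (intro add_left_mono mult_right_mono mult_left_mono) auto
        qed
        also have "\<dots> < \<epsilon>" using n2[OF n_ge(3)] by simp
        finally show ?thesis by simp
      qed
      then show "\<exists>no. \<forall>n\<ge>no. norm (integral\<^sup>L (distr (M n) borel (?V n)) h - L) < \<epsilon>" by blast
    qed
    then show "(\<lambda>n. integral\<^sup>L (distr (M n) borel (?V n)) h) \<longlonglongrightarrow>
      integral\<^sup>L (distr (std_normal_distribution \<Otimes>\<^sub>M std_normal_distribution) borel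
       (\<lambda>z. sqrt (F x0 * (1 - F x0)) *\<^sub>R z)) h"
      unfolding L_eq .
  qed
qed

end
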